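(* Let $\mathrm{sgn}(z)=+1$ if $z>0$, $\mathrm{sgn}(z)=-1$ if $z<0$ and $\mathrm{sgn}(0)=0$. Then for all $\beta\in\mathbb{R}$ and $\eta>0$, $$\mathrm{sgn}\left(\frac{\partial r}{\partial\beta}(\beta,\eta)\right)=-\,\mathrm{sgn}(\eta-1).$$ Hence, for fixed $\eta<1$ the spectral gap $r$ is an increasing function of $\beta$, while it decreases with $\beta$ for fixed $\eta>1$. If $\eta=1$, $r(\beta,1)=1$ is constant.
   Context: For $\beta\in\mathbb{R}$, $\eta>0$, consider the Markov diffusion process on $\mathbb{R}$ whose transition density $p$ satisfies $\partial_t p=-\partial_x[a(x)p]+\partial_x^2p$, with $a(x)=-\beta-\eta x$ for $x\ge0$ and $a(x)=-\beta-x$ for $x\le 0$, $p(x,0)=\delta(x-x_0)$, $p$ and $\partial_xp$ continuous at $x=0$, and decay as $x\to\pm\infty$. Its spectral gap $r(\beta,\eta)$ is the smallest strictly positive $\lambda$ for which $-\psi''+V\psi=(\lambda+\frac12)\psi$ on $\mathbb{R}$ has a nonzero solution $\psi\in L^2(\mathbb{R})$ with $\psi,\psi'$ continuous at $0$, where $V(x)=\frac14(\beta+x)^2$ for $x<0$ and $V(x)=\frac14(\beta+\eta x)^2+\frac{1-\eta}2$ for $x>0$. *)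

theory Defs
  imports "HOL-Analysis.Analysis"
begin

(* The value at 0 is immaterial: the equation below is only imposed off 0. *)
definition potential :: "real \<Rightarrow> real \<Rightarrow> real \<Rightarrow> real" where
  "potential \<beta> \<eta> x =
     (if x < 0 then (\<beta> + x)\<^sup>2 / 4 else (\<beta> + \<eta> * x)\<^sup>2 / 4 + (1 - \<eta>) / 2)"

(* Functions of class C^1 on the line, twice differentiable off 0, where the potential may jump.
   Matching both psi and psi' at 0 is the same as differentiability of psi at 0 together with
   continuity of its derivative there. Such psi are measurable, so square integrability of psi is
   integrability of psi^2. Real-valued psi lose nothing, since the equation has real coefficients
   and the spectral parameter mu is real. *)
definition eigenfunction :: "real \<Rightarrow> real \<Rightarrow> real \<Rightarrow> (real \<Rightarrow> real) \<Rightarrow> bool" where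
  "eigenfunction \<beta> \<eta> \<mu> \<psi> \<longleftrightarrow>
     (\<forall>x. \<psi> differentiable (at x)) \<and>
     isCont (deriv \<psi>) 0 \<and>
     (\<forall>x. x \<noteq> 0 \<longrightarrow>
        deriv \<psi> differentiable (at x) \<and>
        - deriv (deriv \<psi>) x + potential \<beta> \<eta> x * \<psi> x = (\<mu> + 1 / 2) * \<psi> x) \<and>
     integrable lborel (\<lambda>x. (\<psi> x)\<^sup>2) \<and>
     (\<exists>x. \<psi> x \<noteq> 0)"

definition spectral_gap :: "real \<Rightarrow> real \<Rightarrow> real" where
  "spectral_gap \<beta> \<eta> = (LEAST \<mu>. 0 < \<mu> \<and> (\<exists>\<psi>. eigenfunction \<beta> \<eta> \<mu> \<psi>))"

end

theory Submission
  imports Defs "HOL-Real_Asymp.Real_Asymp"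
begin

text \<open>
  Write the eigenfunctions as \<open>\<psi> = e\<^sup>A\<^sup>/\<^sup>2 f\<close> with \<open>A' = a\<close>; then \<open>f'' + a f' = - \<lambda> f\<close>, and \<open>p = f'\<close>
  solves the supersymmetric partner problem. The spectral gap is the unique \<open>\<lambda> > 0\<close> with a positive
  decaying \<open>p\<close>: if another eigenvalue \<open>\<mu> < \<lambda>\<close> had the pair \<open>(F, P)\<close>, then \<open>Z = - (P / p) w\<close> with the
  Wronskian \<open>w = e\<^sup>A (\<mu> F p - \<lambda> f P)\<close> would be increasing and \<open>(w\<^sup>2)'\<close> would have the sign of \<open>Z\<close>,
  which contradicts \<open>w \<rightarrow> 0\<close> at both ends.

  On each half line the decaying solutions are Hermite functions \<open>h\<^sub>s\<close> of real index, so that the gap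
  is determined by \<open>\<rho>\<^sub>1\<^sub>-\<^sub>\<lambda>(-\<beta>) + \<surd>\<eta> \<rho>\<^sub>1\<^sub>-\<^sub>\<lambda>\<^sub>/\<^sub>\<eta>(\<beta> / \<surd>\<eta>) = 0\<close> with \<open>\<rho>\<^sub>s = h\<^sub>s\<^sub>-\<^sub>1 / h\<^sub>s\<close>.
  By the Wronskian identity, \<open>\<rho>\<^sub>s\<close> is strictly increasing in \<open>s\<close> with a difference quotient that has a
  positive limit. In \<open>y\<close>, \<open>\<rho>\<^sub>s\<close> solves a Riccati equation, and the matching condition makes the left and
  right derivatives proportional with ratio \<open>\<eta>\<close>; hence \<open>\<partial>r/\<partial>\<beta>\<close> is \<open>1 - \<eta>\<close> times a positive number as soon
  as \<open>\<rho>\<^sub>s' > 0\<close>, which holds wherever \<open>\<rho>\<^sub>s \<ge> 0\<close>; at the matching point this is true on one of the two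
  sides.
\<close>

section \<open>Integrals over the half line\<close>

lemma integral_Ioi_FTC:
  fixes F f :: "real \<Rightarrow> real"
  assumes F: "\<And>t. t > 0 \<Longrightarrow> (F has_real_derivative f t) (at t)"
    and f: "\<And>t. t > 0 \<Longrightarrow> isCont f t"
    and int: "integrable lborel (\<lambda>t. indicator {0<..} t * f t)"
    and A: "(F \<longlongrightarrow> A) (at_right 0)" and top: "(F \<longlongrightarrow> 0) at_top"
  shows "(\<integral>t. indicator {0<..} t * f t \<partial>lborel) = - A"
proof -
  have "(LBINT x=ereal 0..\<infinity>. f x) = 0 - A"
  proof (rule interval_integral_FTC_integrable)
    show "set_integrable lborel (einterval (ereal 0) \<infinity>) f"
      using int by (simp add: einterval_eq set_integrable_def)
    show "((F \<circ> real_of_ereal) \<longlongrightarrow> A) (at_right (ereal 0))"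
      using A by (simp add: ereal_tendsto_simps)
    show "((F \<circ> real_of_ereal) \<longlongrightarrow> 0) (at_left \<infinity>)"
      using top by (simp add: ereal_tendsto_simps)
  qed (use F f in \<open>auto simp: has_real_derivative_iff_has_vector_derivative\<close>)
  then show ?thesis
    by (simp add: interval_lebesgue_integral_def einterval_eq set_lebesgue_integral_def)
qed

lemma integral_Ioi_pos:
  fixes f :: "real \<Rightarrow> real"
  assumes pos: "\<And>t. t > 0 \<Longrightarrow> f t > 0"
    and int: "integrable lborel (\<lambda>t. indicator {0<..} t * f t)"
  shows "(\<integral>t. indicator {0<..} t * f t \<partial>lborel) > 0"
proof -
  have nn: "AE t in lborel. 0 \<le> indicator {0<..} t * f t"
    using pos by (auto simp: indicator_def less_imp_le)
  \<comment> \<open>If the integrand vanished almost everywhere, the interval (0,1), on which it is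
    positive, would be a null set.\<close>
  have "\<not> (AE t in lborel. indicator {0<..} t * f t = 0)"
  proof
    assume "AE t in lborel. indicator {0<..} t * f t = 0"
    then have "AE t in lborel. t \<notin> {0<..<1::real}"
      by eventually_elim (use pos in \<open>force simp: indicator_def\<close>)
    then have "emeasure lborel {0<..<1::real} = 0"
      by (subst (asm) AE_iff_measurable[OF _ refl]) (auto simp: greaterThanLessThan_def greaterThan_def lessThan_def Int_def)
    then show False by simp
  qed
  then have "(\<integral>t. indicator {0<..} t * f t \<partial>lborel) \<noteq> 0"
    using integral_nonneg_eq_0_iff_AE[OF int nn] by blast
  moreover have "(\<integral>t. indicator {0<..} t * f t \<partial>lborel) \<ge> 0"
    by (rule integral_nonneg_AE[OF nn])
  ultimately show ?thesis by linarith
qed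

text \<open>Continuity in a metric space can be tested on sequences, so dominated convergence with
  the common majorant \<open>g\<close> suffices.\<close>

lemma continuous_on_integral_dominated:
  fixes f :: "'a::metric_space \<Rightarrow> real \<Rightarrow> real"
  assumes meas: "\<And>p. p \<in> A \<Longrightarrow> f p \<in> borel_measurable lborel"
    and cont: "\<And>t. continuous_on A (\<lambda>p. f p t)"
    and g: "integrable lborel g"
    and bound: "\<And>p t. p \<in> A \<Longrightarrow> \<bar>f p t\<bar> \<le> g t"
  shows "continuous_on A (\<lambda>p. \<integral>t. f p t \<partial>lborel)"
  unfolding continuous_on_sequentially
proof (intro allI ballI impI)
  fix x a assume a: "a \<in> A" and x: "(\<forall>n. x n \<in> A) \<and> x \<longlonglongrightarrow> a"
  have "(\<lambda>n. f (x n) t) \<longlonglongrightarrow> f a t" for t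
    using cont[of t] a x unfolding continuous_on_sequentially by (auto simp: o_def)
  then have "(\<lambda>n. \<integral>t. f (x n) t \<partial>lborel) \<longlonglongrightarrow> (\<integral>t. f a t \<partial>lborel)"
    by (intro integral_dominated_convergence[where w = g]) (use meas bound a x g in auto)
  then show "((\<lambda>p. \<integral>t. f p t \<partial>lborel) \<circ> x) \<longlonglongrightarrow> (\<integral>t. f a t \<partial>lborel)"
    by (simp add: o_def)
qed

section \<open>Hermite functions of real index\<close>

text \<open>Integrating \<open>dens\<close> over t > 0 gives the Mellin transform of a shifted
  Gaussian. In classical terms it is Gamma(s) exp(y^2/4) D_{-s}(y), with D the parabolic cylinder
  function.\<close>

definition dens :: "real \<Rightarrow> real \<Rightarrow> real \<Rightarrow> real" where
  "dens s y t = t powr (s - 1) * exp (- t\<^sup>2 / 2 - y * t)"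

definition mellin :: "real \<Rightarrow> real \<Rightarrow> real" where
  "mellin s y = (\<integral>t. indicator {0<..} t * dens s y t \<partial>lborel)"

section \<open>Mellin integral: domination, continuity, derivative and recurrence\<close>

lemma dens_measurable [measurable]: "dens s y \<in> borel_measurable borel"
  unfolding dens_def by measurable

lemma integrable_powr_exp:
  fixes s :: real
  assumes "s > 0"
  shows "integrable lborel (\<lambda>t. indicator {0<..} t * (t powr (s - 1) * exp (- t)))"
proof -
  have "(\<lambda>t. t powr (s - 1) / exp t) absolutely_integrable_on {0..}"
    using Gamma_integral_real[OF assms]
    by (intro nonnegative_absolutely_integrable_1) (auto simp: integrable_on_def)
  then have "set_integrable lebesgue {0<..} (\<lambda>t. t powr (s - 1) * exp (- t))"
    by (rule set_integrable_subset[THEN set_integrable_cong[THEN iffD1, rotated -1]])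
       (auto simp: exp_minus field_simps)
  then show ?thesis
    unfolding set_integrable_def by (simp add: integrable_completion)
qed

text \<open>One integrable majorant serves a whole box of parameters. The power is dominated by the
  smallest exponent for t <= 1 and by the largest for t > 1, and expanding (t - (Y + 1))^2 >= 0
  trades the Gaussian for exp(-t).\<close>

lemma dens_bound:
  assumes "s0 \<le> s" "s \<le> s1" "\<bar>y\<bar> \<le> Y" "t > 0"
  shows "dens s y t \<le> exp ((Y + 1)\<^sup>2 / 2) * (t powr (s0 - 1) * exp (- t) + t powr (s1 - 1) * exp (- t))"
proof -
  have "t powr (s - 1) \<le> t powr (s0 - 1) + t powr (s1 - 1)"
  proof (cases "t \<le> 1")
    case True
    then have "t powr (s - 1) \<le> t powr (s0 - 1)"
      using assms by (intro powr_mono') auto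
    then show ?thesis by (simp add: add_increasing2)
  next
    case False
    then have "t powr (s - 1) \<le> t powr (s1 - 1)"
      using assms by (intro powr_mono) auto
    then show ?thesis by (simp add: add_increasing)
  qed
  moreover have "exp (- t\<^sup>2 / 2 - y * t) \<le> exp ((Y + 1)\<^sup>2 / 2) * exp (- t)"
  proof -
    have "- y * t \<le> Y * t" using assms by (intro mult_right_mono) auto
    moreover have "0 \<le> (t - (Y + 1))\<^sup>2" by simp
    ultimately have "- t\<^sup>2 / 2 - y * t \<le> (Y + 1)\<^sup>2 / 2 - t"
      by (simp add: power2_eq_square algebra_simps)
    then have "exp (- t\<^sup>2 / 2 - y * t) \<le> exp ((Y + 1)\<^sup>2 / 2 - t)" by simp
    also have "\<dots> = exp ((Y + 1)\<^sup>2 / 2) * exp (- t)"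
      by (simp flip: exp_add)
    finally show ?thesis .
  qed
  ultimately have "dens s y t \<le> (t powr (s0 - 1) + t powr (s1 - 1)) * (exp ((Y + 1)\<^sup>2 / 2) * exp (- t))"
    unfolding dens_def by (intro mult_mono) auto
  then show ?thesis by (simp add: algebra_simps)
qed

lemma dens_dominated:
  assumes "s0 \<le> s" "s \<le> s1" "\<bar>y\<bar> \<le> Y"
  shows "\<bar>indicator {0<..} t * dens s y t\<bar> \<le> exp ((Y + 1)\<^sup>2 / 2) *
    (indicator {0<..} t * (t powr (s0 - 1) * exp (- t)) + indicator {0<..} t * (t powr (s1 - 1) * exp (- t)))"
proof (cases "t > 0")
  case True
  have "dens s y t \<ge> 0" by (simp add: dens_def)
  then show ?thesis using dens_bound[OF assms True] True by simp
qed simp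

lemma integrable_dens:
  assumes "s > 0"
  shows "integrable lborel (\<lambda>t. indicator {0<..} t * dens s y t)"
proof (rule Bochner_Integration.integrable_bound)
  show "integrable lborel (\<lambda>t. exp ((\<bar>y\<bar> + 1)\<^sup>2 / 2) *
    (indicator {0<..} t * (t powr (s - 1) * exp (- t)) + indicator {0<..} t * (t powr (s - 1) * exp (- t))))"
    using integrable_powr_exp[OF assms] by (intro integrable_mult_right Bochner_Integration.integrable_add)
  show "AE t in lborel. norm (indicator {0<..} t * dens s y t) \<le> norm (exp ((\<bar>y\<bar> + 1)\<^sup>2 / 2) *
    (indicator {0<..} t * (t powr (s - 1) * exp (- t)) + indicator {0<..} t * (t powr (s - 1) * exp (- t))))"
    using order_trans[OF dens_dominated[of s s s y "\<bar>y\<bar>"] abs_ge_self]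
    by (intro always_eventually allI) (simp only: real_norm_def order.refl)
qed simp

lemma mellin_pos: "s > 0 \<Longrightarrow> mellin s y > 0"
  unfolding mellin_def
  by (intro integral_Ioi_pos integrable_dens) (auto simp: dens_def)

text \<open>The majorants are uniform only on boxes. Every point of the open half plane is interior
  to such a box, and continuity is local.\<close>

lemma continuous_on_UNIV_from_boxes:
  fixes f :: "real \<times> real \<Rightarrow> real"
  assumes "\<And>a b Y. a0 < a \<Longrightarrow> continuous_on ({a..b} \<times> {-Y..Y}) f"
  shows "continuous_on ({a0<..} \<times> UNIV) f"
proof (rule continuous_at_imp_continuous_on, rule ballI)
  fix p :: "real \<times> real" assume "p \<in> {a0<..} \<times> UNIV"
  then obtain s y where p: "p = (s, y)" "a0 < s" by auto
  define a where "a = (a0 + s) / 2"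
  have "continuous_on ({a..s + 1} \<times> {-(\<bar>y\<bar> + 1)..\<bar>y\<bar> + 1}) f"
    by (rule assms) (use p in \<open>simp add: a_def\<close>)
  moreover have "p \<in> {a<..<s + 1} \<times> {-(\<bar>y\<bar> + 1)<..<\<bar>y\<bar> + 1}"
    using p by (auto simp: a_def)
  moreover have "open ({a<..<s + 1} \<times> {-(\<bar>y\<bar> + 1)<..<\<bar>y\<bar> + 1})"
    by (intro open_Times open_greaterThanLessThan)
  moreover have "{a<..<s + 1} \<times> {-(\<bar>y\<bar> + 1)<..<\<bar>y\<bar> + 1} \<subseteq> {a..s + 1} \<times> {-(\<bar>y\<bar> + 1)..\<bar>y\<bar> + 1}"
    by auto
  ultimately show "isCont f p"
    by (meson continuous_on_eq_continuous_at continuous_on_subset)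
qed

lemma mellin_continuous: "continuous_on ({0<..} \<times> UNIV) (\<lambda>(s, y). mellin s y)"
proof (rule continuous_on_UNIV_from_boxes)
  fix a b Y :: real assume a: "0 < a"
  show "continuous_on ({a..b} \<times> {-Y..Y}) (\<lambda>(s, y). mellin s y)"
  proof (cases "a \<le> b")
    case True
    have "continuous_on ({a..b} \<times> {-Y..Y}) (\<lambda>p. \<integral>t. indicator {0<..} t * dens (fst p) (snd p) t \<partial>lborel)"
    proof (rule continuous_on_integral_dominated)
      show "continuous_on ({a..b} \<times> {-Y..Y}) (\<lambda>p. indicator {0<..} t * dens (fst p) (snd p) t)" for t :: real
        by (cases "t > 0") (auto simp: dens_def indicator_def intro!: continuous_intros)
      show "integrable lborel (\<lambda>t. exp ((Y + 1)\<^sup>2 / 2) *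
        (indicator {0<..} t * (t powr (a - 1) * exp (- t)) + indicator {0<..} t * (t powr (b - 1) * exp (- t))))"
        using integrable_powr_exp a True by (intro integrable_mult_right Bochner_Integration.integrable_add) auto
    qed (auto intro!: dens_dominated)
    then show ?thesis by (simp add: mellin_def case_prod_unfold)
  qed auto
qed

lemma mellin_isCont: "s > 0 \<Longrightarrow> isCont (mellin s) y"
proof -
  assume "s > 0"
  then have "continuous_on UNIV (\<lambda>y. (\<lambda>(s, y). mellin s y) (s, y))"
    by (intro continuous_on_compose2[OF mellin_continuous]) (auto intro!: continuous_intros)
  then show ?thesis by (simp add: continuous_on_eq_continuous_at)
qed

text \<open>Convexity in y: exp(-h t) >= 1 - h t is inserted under the integral. This carries the
  differentiation of the integral in \<open>mellin_deriv\<close>.\<close>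

lemma mellin_tangent:
  assumes "s > 0"
  shows "mellin s (y + h) \<ge> mellin s y - h * mellin (s + 1) y"
proof -
  have "mellin s y - h * mellin (s + 1) y =
      (\<integral>t. indicator {0<..} t * dens s y t - h * (indicator {0<..} t * dens (s + 1) y t) \<partial>lborel)"
    using assms integrable_dens[of s] integrable_dens[of "s + 1"] unfolding mellin_def
    by (subst Bochner_Integration.integral_diff) auto
  also have "\<dots> \<le> mellin s (y + h)"
    unfolding mellin_def
  proof (rule integral_mono)
    fix t :: real
    show "indicator {0<..} t * dens s y t - h * (indicator {0<..} t * dens (s + 1) y t)
        \<le> indicator {0<..} t * dens s (y + h) t"
    proof (cases "t > 0")
      case True
      have *: "dens (s + 1) y t = t * dens s y t"
        using True by (simp add: dens_def powr_diff)
      have "dens s (y + h) t = dens s y t * exp (- h * t)"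
        by (simp add: dens_def exp_add [symmetric] algebra_simps)
      moreover have "dens s y t * (1 + (- h * t)) \<le> dens s y t * exp (- h * t)"
        by (intro mult_left_mono exp_ge_add_one_self) (simp add: dens_def)
      ultimately show ?thesis using True * by (simp add: algebra_simps)
    qed simp
  qed (use assms integrable_dens in auto)
  finally show ?thesis .
qed

text \<open>The tangent inequalities at y and at y + h trap the remainder between 0 and h times an
  increment of \<open>mellin (s + 1)\<close>, which tends to 0 by continuity.\<close>

lemma mellin_deriv:
  assumes s: "s > 0"
  shows "(mellin s has_real_derivative - mellin (s + 1) y) (at y)"
  unfolding has_field_derivative_def has_derivative_at
proof (intro conjI)
  show "bounded_linear ((*) (- mellin (s + 1) y))" by (rule bounded_linear_mult_right)
  have c: "((\<lambda>h. \<bar>mellin (s + 1) (y + h) - mellin (s + 1) y\<bar>) \<longlongrightarrow> 0) (at 0)"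
  proof -
    have "isCont (mellin (s + 1)) y" using s by (intro mellin_isCont) auto
    then have "((\<lambda>h. mellin (s + 1) (y + h)) \<longlongrightarrow> mellin (s + 1) y) (at 0)"
      by (simp add: isCont_iff)
    then show ?thesis by (simp add: LIM_zero_iff tendsto_rabs_zero_iff)
  qed
  show "((\<lambda>h. norm (mellin s (y + h) - mellin s y - - mellin (s + 1) y * h) / norm h) \<longlongrightarrow> 0) (at 0)"
  proof (rule tendsto_sandwich[OF _ _ tendsto_const c])
    show "\<forall>\<^sub>F h in at 0. norm (mellin s (y + h) - mellin s y - - mellin (s + 1) y * h) / norm h
        \<le> \<bar>mellin (s + 1) (y + h) - mellin (s + 1) y\<bar>"
    proof (rule eventually_at_filter[THEN iffD2], rule always_eventually, intro allI impI)
      fix h :: real assume h: "h \<noteq> 0"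
      let ?r = "mellin s (y + h) - mellin s y + mellin (s + 1) y * h"
      have 1: "?r \<ge> 0" using mellin_tangent[OF s, of y h] by (simp add: mult.commute)
      have 2: "?r \<le> h * (mellin (s + 1) y - mellin (s + 1) (y + h))"
        using mellin_tangent[OF s, of "y + h" "-h"] by (simp add: algebra_simps)
      also have "\<dots> \<le> \<bar>h\<bar> * \<bar>mellin (s + 1) (y + h) - mellin (s + 1) y\<bar>"
        using abs_ge_self[of "h * (mellin (s + 1) y - mellin (s + 1) (y + h))"]
        by (simp add: abs_mult abs_minus_commute)
      finally show "norm (mellin s (y + h) - mellin s y - - mellin (s + 1) y * h) / norm h
        \<le> \<bar>mellin (s + 1) (y + h) - mellin (s + 1) y\<bar>"
        using 1 h by (simp add: divide_simps mult.commute)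
    qed
  qed (simp add: always_eventually)
qed

text \<open>Integrate the derivative of t^s exp(-t^2/2 - y t) over the half line. Both boundary
  values are 0, at the origin because s > 0.\<close>

lemma mellin_recurrence:
  assumes s: "s > 0"
  shows "s * mellin s y = y * mellin (s + 1) y + mellin (s + 2) y"
proof -
  define F where "F t = t powr s * exp (- t\<^sup>2 / 2 - y * t)" for t :: real
  define f where "f t = s * dens s y t - y * dens (s + 1) y t - dens (s + 2) y t" for t
  have i: "integrable lborel (\<lambda>t. indicator {0<..} t * dens s y t)"
    "integrable lborel (\<lambda>t. indicator {0<..} t * dens (s + 1) y t)"
    "integrable lborel (\<lambda>t. indicator {0<..} t * dens (s + 2) y t)"
    using s by (auto intro: integrable_dens)
  have e: "indicator {0<..} t * f t = s * (indicator {0<..} t * dens s y t)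
      - y * (indicator {0<..} t * dens (s + 1) y t) - indicator {0<..} t * dens (s + 2) y t" for t
    by (simp add: f_def algebra_simps)
  have "(\<integral>t. indicator {0<..} t * f t \<partial>lborel) = - 0"
  proof (rule integral_Ioi_FTC)
    show "(F has_real_derivative f t) (at t)" if "t > 0" for t
    proof -
      define E where "E = exp (- t\<^sup>2 / 2 - y * t)"
      have "(F has_real_derivative s * t powr (s - 1) * E + t powr s * (E * (- t - y))) (at t)"
        unfolding F_def E_def using that
        by (auto intro!: derivative_eq_intros simp: power2_eq_square)
      moreover have "t powr s = t * t powr (s - 1)" "t powr (s + 1) = t * t * t powr (s - 1)"
        using that by (auto simp: powr_add powr_diff)
      then have "f t = s * t powr (s - 1) * E + t powr s * (E * (- t - y))"
        unfolding f_def dens_def E_def [symmetric] by (simp add: algebra_simps)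
      ultimately show ?thesis by simp
    qed
    show "isCont f t" if "t > 0" for t
      unfolding f_def dens_def using that by (intro continuous_intros) auto
    show "integrable lborel (\<lambda>t. indicator {0<..} t * f t)"
      unfolding e using i by (intro Bochner_Integration.integrable_diff integrable_mult_right)
    have "((\<lambda>t. t powr s) \<longlongrightarrow> 0) (at_right 0)" using s by real_asymp
    moreover have "((\<lambda>t. exp (- t\<^sup>2 / 2 - y * t)) \<longlongrightarrow> exp (- 0\<^sup>2 / 2 - y * 0)) (at_right 0)"
      by (intro tendsto_intros) simp_all
    ultimately show "(F \<longlongrightarrow> 0) (at_right 0)"
      unfolding F_def using tendsto_mult[of _ 0] by fastforce
    show "(F \<longlongrightarrow> 0) at_top" unfolding F_def using s by real_asymp
  qed
  then show ?thesis
    unfolding e mellin_def using i by simp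
qed

text \<open>
  The solution of \<open>u'' - y u' - s u = 0\<close> that grows only like \<open>y\<^sup>-\<^sup>s\<close> at infinity, i.e. the classical
  Hermite function of degree \<open>-s\<close>. Dividing by \<open>\<Gamma>(s)\<close> removes the pole of the Mellin integral at \<open>s = 0\<close>,
  and the three-term recurrence continues it to \<open>s \<le> 0\<close>.
\<close>

function hermite :: "real \<Rightarrow> real \<Rightarrow> real" where
  "hermite s y = (if s > 0 then mellin s y / Gamma s else y * hermite (s + 1) y + (s + 1) * hermite (s + 2) y)"
  by pat_completeness auto
termination
  by (relation "Wellfounded.measure (\<lambda>(s, y). nat \<lceil>1 - s\<rceil>)") (auto, linarith+)

declare hermite.simps [simp del]

lemma hermite_pos_def: "s > 0 \<Longrightarrow> hermite s y = mellin s y / Gamma s"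
  by (subst hermite.simps) simp

lemma hermite_rec: "hermite s y = y * hermite (s + 1) y + (s + 1) * hermite (s + 2) y"
proof (cases "s > 0")
  case True
  have G: "Gamma (s + 1) = s * Gamma s" "Gamma (s + 2) = (s + 1) * (s * Gamma s)"
    using True Gamma_plus1[of s] Gamma_plus1[of "s + 1"]
    by (auto simp: add.assoc nonpos_Ints_def)
  have "Gamma s > 0" using True by (rule Gamma_real_pos)
  then have "y * hermite (s + 1) y + (s + 1) * hermite (s + 2) y
      = (y * mellin (s + 1) y + mellin (s + 2) y) / (s * Gamma s)"
    using True by (simp add: hermite_pos_def G divide_simps)
  also have "\<dots> = mellin s y / Gamma s"
    using True \<open>Gamma s > 0\<close> by (simp add: mellin_recurrence [symmetric])
  finally show ?thesis using True by (simp add: hermite_pos_def)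
qed (subst hermite.simps, simp)

lemma hermite_pred: "hermite (s - 1) y = y * hermite s y + s * hermite (s + 1) y"
  using hermite_rec[of "s - 1" y] by (simp add: algebra_simps)

text \<open>This induction follows the recursion of \<open>hermite\<close>: positive indices are the
  base, and each other index rests on the next two above it.\<close>

lemma real_down_induct [case_names pos step]:
  fixes s :: real
  assumes pos: "\<And>s. s > 0 \<Longrightarrow> P s"
    and step: "\<And>s. s \<le> 0 \<Longrightarrow> P (s + 1) \<Longrightarrow> P (s + 2) \<Longrightarrow> P s"
  shows "P s"
proof (induction "nat \<lceil>1 - s\<rceil>" arbitrary: s rule: less_induct)
  case less
  show ?case
  proof (cases "s > 0")
    case False
    then have "nat \<lceil>1 - (s + 1)\<rceil> < nat \<lceil>1 - s\<rceil>" "nat \<lceil>1 - (s + 2)\<rceil> < nat \<lceil>1 - s\<rceil>" by linarith+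
    then show ?thesis using less step False by auto
  qed (rule pos)
qed

lemma hermite_deriv: "(hermite s has_real_derivative - s * hermite (s + 1) y) (at y)"
proof (induction s arbitrary: y rule: real_down_induct)
  case (pos s)
  have "((\<lambda>y. mellin s y / Gamma s) has_real_derivative - mellin (s + 1) y / Gamma s) (at y)"
    by (intro DERIV_cdivide mellin_deriv pos)
  moreover have "Gamma (s + 1) = s * Gamma s"
    using pos Gamma_plus1[of s] by (auto simp: nonpos_Ints_def)
  then have "- mellin (s + 1) y / Gamma s = - s * hermite (s + 1) y"
    using pos Gamma_real_pos[OF pos] by (simp add: hermite_pos_def)
  moreover have "hermite s = (\<lambda>y. mellin s y / Gamma s)"
    using pos by (auto simp: hermite_pos_def)
  ultimately show ?case by simp
next
  case (step s)
  have e: "hermite s = (\<lambda>y. y * hermite (s + 1) y + (s + 1) * hermite (s + 2) y)"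
    using hermite_rec by blast
  have D: "((\<lambda>y. y * hermite (s + 1) y + (s + 1) * hermite (s + 2) y) has_real_derivative
      (hermite (s + 1) y + y * (- (s + 1) * hermite (s + 1 + 1) y)) + (s + 1) * (- (s + 2) * hermite (s + 2 + 1) y)) (at y)"
    by (rule derivative_eq_intros step refl | simp)+
  have A: "y * hermite (s + 2) y + (s + 2) * hermite (s + 3) y = hermite (s + 1) y"
    using hermite_rec[of "s + 1" y] by (simp add: add.assoc)
  have "hermite (s + 1) y + y * (- (s + 1) * hermite (s + 1 + 1) y) + (s + 1) * (- (s + 2) * hermite (s + 2 + 1) y)
      = hermite (s + 1) y - (s + 1) * (y * hermite (s + 2) y + (s + 2) * hermite (s + 3) y)"
    by (simp add: algebra_simps)
  also have "\<dots> = - s * hermite (s + 1) y" unfolding A by (simp add: algebra_simps)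
  finally have "hermite (s + 1) y + y * (- (s + 1) * hermite (s + 1 + 1) y) + (s + 1) * (- (s + 2) * hermite (s + 2 + 1) y)
      = - s * hermite (s + 1) y" .
  with D show ?case
    unfolding e by (simp only:)
qed

text \<open>Joint continuity spreads from s > 0 to s > -n by induction on n, since the recurrence
  expresses index s through s + 1 and s + 2.\<close>

lemma hermite_continuous: "continuous_on UNIV (\<lambda>(s, y). hermite s y)"
proof -
  have *: "continuous_on ({- real n<..} \<times> UNIV) (\<lambda>p. hermite (fst p) (snd p))" for n
  proof (induction n)
    case 0
    have *: "p \<in> {0::real<..} \<times> (UNIV::real set) \<Longrightarrow> fst p \<notin> \<int>\<^sub>\<le>\<^sub>0" for p
      by (auto simp: nonpos_Ints_def)
    have "continuous_on ({0::real<..} \<times> (UNIV::real set)) (\<lambda>p. Gamma (fst p))"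
      by (rule continuous_on_compose2[OF continuous_on_Gamma[of "{0<..}"]])
         (auto simp: nonpos_Ints_def intro!: continuous_intros)
    then have "continuous_on ({0<..} \<times> UNIV) (\<lambda>p. (\<lambda>(s, y). mellin s y) p / Gamma (fst p))"
      by (intro continuous_on_divide mellin_continuous ballI) (simp_all only: Gamma_eq_zero_iff *, simp)
    then have "continuous_on ({0<..} \<times> UNIV) (\<lambda>p. hermite (fst p) (snd p))"
      by (rule continuous_on_eq) (auto simp: hermite_pos_def)
    then show ?case by simp
  next
    case (Suc n)
    have "continuous_on ({- real (Suc n)<..} \<times> UNIV)
      (\<lambda>p. snd p * hermite (fst p + 1) (snd p) + (fst p + 1) * hermite (fst p + 2) (snd p))"
    proof -
      have "continuous_on ({- real (Suc n)<..} \<times> UNIV) (\<lambda>p. hermite (fst (fst p + k, snd p)) (snd (fst p + k, snd p)))"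
        if "k \<ge> 1" for k
        by (rule continuous_on_compose2[OF Suc]) (use that in \<open>auto intro!: continuous_intros\<close>)
      from this[of 1] this[of 2] show ?thesis
        by (intro continuous_on_add continuous_on_mult continuous_on_fst continuous_on_snd
            continuous_on_id continuous_on_const) simp_all
    qed
    then show ?case
      by (rule continuous_on_eq) (simp flip: hermite_rec)
  qed
  show ?thesis
  proof (rule continuous_at_imp_continuous_on, rule ballI)
    fix p :: "real \<times> real"
    obtain n where "- fst p < real n" using reals_Archimedean2 by blast
    then have "p \<in> {- real n<..} \<times> UNIV" by (cases p) auto
    then show "isCont (\<lambda>(s, y). hermite s y) p"
      using *[of n] unfolding case_prod_unfold
      by (subst (asm) continuous_on_eq_continuous_at) (auto intro: open_Times)
  qed
qed

lemma continuous_on_hermite [continuous_intros]: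
  assumes "continuous_on A f" "continuous_on A g"
  shows "continuous_on A (\<lambda>x. hermite (f x) (g x))"
proof -
  have "continuous_on A (\<lambda>x. (\<lambda>(s, y). hermite s y) (f x, g x))"
    by (intro continuous_on_compose2[OF hermite_continuous] continuous_intros assms) auto
  then show ?thesis by simp
qed

lemma tendsto_hermite [tendsto_intros]:
  assumes "(f \<longlongrightarrow> a) F" "(g \<longlongrightarrow> b) F"
  shows "((\<lambda>x. hermite (f x) (g x)) \<longlongrightarrow> hermite a b) F"
proof -
  have "isCont (\<lambda>(s, y). hermite s y) (a, b)"
    using hermite_continuous by (simp add: continuous_on_eq_continuous_at)
  from isCont_tendsto_compose[OF this tendsto_Pair[OF assms]] show ?thesis by simp
qed

section \<open>Zeros, positivity and growth of Hermite functions\<close>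

lemma hermite_zero_const: "hermite 0 y = hermite 0 0"
proof -
  have "(hermite 0 has_real_derivative 0) (at x)" for x
    using hermite_deriv[of 0 x] by simp
  then show ?thesis using DERIV_const_ratio_const[of "0" y] DERIV_isconst_all by blast
qed

lemma hermite_pos: "s \<ge> 0 \<Longrightarrow> hermite s y > 0"
proof -
  have *: "hermite s y > 0" if "s > 0" for s y
    using that by (simp add: hermite_pos_def mellin_pos Gamma_real_pos)
  assume "s \<ge> 0"
  \<comment> \<open>Index 0 lies outside \<open>hermite_pos_def\<close>. At argument 0 the
    recurrence leaves only \<open>hermite 2 0\<close>, and \<open>hermite 0\<close> is
    constant.\<close>
  moreover have "hermite 0 y > 0"
    using hermite_rec[of 0 0] *[of 2 0] hermite_zero_const[of y] by simp
  ultimately show ?thesis using * by (cases "s = 0") auto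
qed

text \<open>The recurrence would push two consecutive zeros up the indices until a positive index is
  reached. The coefficient s + 1 vanishes only at s = -1, where positivity of
  \<open>hermite 0\<close> intervenes. For s nonzero this says that zeros in y are simple.\<close>

lemma hermite_no_double_zero: "\<not> (hermite s y = 0 \<and> hermite (s + 1) y = 0)"
proof (induction s rule: real_down_induct)
  case (pos s)
  then show ?case using hermite_pos[of s y] by auto
next
  case (step s)
  show ?case
  proof (cases "s = -1")
    case True
    then show ?thesis using hermite_pos[of 0 y] by auto
  next
    case False
    then show ?thesis
      using step hermite_rec[of s y] by (auto simp: add.assoc)
  qed
qed

text \<open>The ratio bound t/2 is the invariant that survives lowering the index: the negative term
  in h_{s-1} = t h_s + s h_{s+1} is at most (t^2/4) h_{s+1}, which the previous bound limits to
  (t/2) h_s, half of the leading term.\<close>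

lemma hermite_large_pos:
  assumes "t > 0" "t\<^sup>2 \<ge> 4 * real n" "s \<ge> - real n"
  shows "hermite s t > 0 \<and> hermite (s - 1) t \<ge> t / 2 * hermite s t"
  using assms(2,3)
proof (induction n arbitrary: s)
  case 0
  have p: "hermite s t > 0" "hermite (s + 1) t > 0" using 0 by (auto intro!: hermite_pos)
  then have "0 \<le> s * hermite (s + 1) t" "0 \<le> t * hermite s t" using 0 assms by auto
  then show ?case using p by (simp add: hermite_pred)
next
  case (Suc n)
  show ?case
  proof (cases "s \<ge> - real n")
    case True
    then show ?thesis using Suc by auto
  next
    case False
    then have s: "s + 1 \<ge> - real n" "s \<le> 0" "- s \<le> real n + 1" using Suc by auto
    then have IH: "hermite (s + 1) t > 0" "hermite s t \<ge> t / 2 * hermite (s + 1) t"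
      using Suc.IH[of "s + 1"] Suc.prems by auto
    then have p: "hermite s t > 0" using assms(1) by (smt (verit) mult_pos_pos half_gt_zero)
    have "(- s) * hermite (s + 1) t \<le> (real n + 1) * hermite (s + 1) t"
      using s IH by (intro mult_right_mono) auto
    also have "\<dots> \<le> (t\<^sup>2 / 4) * hermite (s + 1) t"
      using Suc.prems IH by (intro mult_right_mono) auto
    also have "\<dots> = t / 2 * (t / 2 * hermite (s + 1) t)" by (simp add: power2_eq_square)
    also have "\<dots> \<le> t / 2 * hermite s t" using IH assms(1) by (intro mult_left_mono) auto
    finally have "(- s) * hermite (s + 1) t \<le> t / 2 * hermite s t" .
    then show ?thesis using p by (simp add: hermite_pred)
  qed
qed

text \<open>For indices in [1, M] the function is positive and decreasing, hence bounded by its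
  value at \<open>Y\<close>, uniformly by compactness. Each application of the recurrence then costs
  at most a factor linear in |t|, absorbed by exp |t|.\<close>

lemma hermite_growth_step:
  "\<exists>C\<ge>0. \<forall>s\<in>{1 - real n..M}. \<forall>t\<ge>Y. \<bar>hermite s t\<bar> \<le> C * exp (real n * \<bar>t\<bar>)"
  if M: "M \<ge> 3"
proof (induction n)
  case 0
  have c: "compact ((\<lambda>s. hermite s Y) ` {1..M})"
    by (rule compact_continuous_image[OF continuous_on_hermite[OF continuous_on_id continuous_on_const]]) simp
  obtain C where C0: "\<And>x. x \<in> (\<lambda>s. hermite s Y) ` {1..M} \<Longrightarrow> norm x \<le> C"
    using compact_imp_bounded[OF c] unfolding bounded_iff by metis
  have C: "\<And>s. s \<in> {1..M} \<Longrightarrow> \<bar>hermite s Y\<bar> \<le> C"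
    using C0[OF imageI] unfolding real_norm_def .
  have "\<bar>hermite s t\<bar> \<le> C" if "s \<in> {1..M}" "t \<ge> Y" for s t
  proof -
    have "hermite s t \<le> hermite s Y"
    proof (rule DERIV_nonpos_imp_nonincreasing[OF \<open>t \<ge> Y\<close>])
      fix x
      have "- s * hermite (s + 1) x \<le> 0" using that hermite_pos[of "s + 1" x] by auto
      then show "\<exists>y. (hermite s has_real_derivative y) (at x) \<and> y \<le> 0" using hermite_deriv by blast
    qed
    then show ?thesis using C[OF that(1)] hermite_pos[of s t] hermite_pos[of s Y] that by auto
  qed
  moreover have "C \<ge> 0" using C[of 1] M by auto
  ultimately show ?case by (intro exI[of _ C]) auto
next
  case (Suc n)
  then obtain C where C: "C \<ge> 0"
    "\<And>s t. s \<in> {1 - real n..M} \<Longrightarrow> t \<ge> Y \<Longrightarrow> \<bar>hermite s t\<bar> \<le> C * exp (real n * \<bar>t\<bar>)"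
    by blast
  let ?D = "(real n + 3) * C"
  have "\<bar>hermite s t\<bar> \<le> ?D * exp (real (Suc n) * \<bar>t\<bar>)" if st: "s \<in> {1 - real (Suc n)..M}" "t \<ge> Y" for s t
  proof -
    define E where "E = exp (real n * \<bar>t\<bar>)"
    have E: "exp (real (Suc n) * \<bar>t\<bar>) = E * exp \<bar>t\<bar>" "E > 0"
      by (auto simp: E_def algebra_simps exp_add)
    have e1: "1 + \<bar>t\<bar> \<le> exp \<bar>t\<bar>" by (rule exp_ge_add_one_self)
    show ?thesis
    proof (cases "s \<ge> 1 - real n")
      case True
      then have "\<bar>hermite s t\<bar> \<le> C * E" using C st by (auto simp: E_def)
      also have "\<dots> \<le> ?D * (E * exp \<bar>t\<bar>)"
        using C(1) E e1 by (intro mult_mono) (auto simp: algebra_simps)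
      finally show ?thesis using E by simp
    next
      case False
      \<comment> \<open>Here s < 1 - n <= 1, hence s + 2 < 3 <= M; this is the purpose of the bound
        on \<open>M\<close>.\<close>
      then have s: "s + 1 \<in> {1 - real n..M}" "s + 2 \<in> {1 - real n..M}" "\<bar>s + 1\<bar> \<le> real n + 2"
        using st M False by auto
      have "\<bar>hermite s t\<bar> \<le> \<bar>t\<bar> * \<bar>hermite (s + 1) t\<bar> + \<bar>s + 1\<bar> * \<bar>hermite (s + 2) t\<bar>"
        by (subst hermite_rec) (metis abs_mult abs_triangle_ineq)
      also have "\<dots> \<le> \<bar>t\<bar> * (C * E) + (real n + 2) * (C * E)"
        using C s st unfolding E_def by (intro add_mono mult_mono) auto
      also have "\<dots> \<le> (real n + 3) * exp \<bar>t\<bar> * (C * E)"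
      proof -
        have "\<bar>t\<bar> + (real n + 2) \<le> (real n + 3) * (1 + \<bar>t\<bar>)" by (simp add: algebra_simps)
        also have "\<dots> \<le> (real n + 3) * exp \<bar>t\<bar>" using e1 by (intro mult_left_mono) auto
        finally have "(\<bar>t\<bar> + (real n + 2)) * (C * E) \<le> (real n + 3) * exp \<bar>t\<bar> * (C * E)"
          using C(1) E by (intro mult_right_mono) auto
        then show ?thesis by (simp add: algebra_simps)
      qed
      finally show ?thesis using E by (simp add: algebra_simps)
    qed
  qed
  then show ?case using C(1) by (intro exI[of _ ?D]) auto
qed

text \<open>The rate 1/8 is chosen so that a product of two Hermite functions grows at most like
  exp(t^2/4), which leaves a Gaussian factor to spare against the weight exp(-t^2/2).\<close>

lemma hermite_growth:
  "\<exists>C\<ge>0. \<forall>s. \<bar>s\<bar> \<le> m \<longrightarrow> (\<forall>t\<ge>Y. \<bar>hermite s t\<bar> \<le> C * exp (t\<^sup>2 / 8))"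
proof -
  obtain n :: nat where n: "1 - real n \<le> - m"
    using real_arch_simple[of "1 + m"] by (auto simp: algebra_simps)
  obtain C where C: "C \<ge> 0" "\<And>s t. s \<in> {1 - real n..max 3 m} \<Longrightarrow> t \<ge> Y \<Longrightarrow>
      \<bar>hermite s t\<bar> \<le> C * exp (real n * \<bar>t\<bar>)"
    using hermite_growth_step[of "max 3 m" n Y] by auto
  have "\<bar>hermite s t\<bar> \<le> C * exp (2 * (real n)\<^sup>2) * exp (t\<^sup>2 / 8)" if "\<bar>s\<bar> \<le> m" "t \<ge> Y" for s t
  proof -
    have "s \<in> {1 - real n..max 3 m}" using that n by auto
    have "0 \<le> (\<bar>t\<bar> - 4 * real n)\<^sup>2" by simp
    also have "\<dots> = t\<^sup>2 - 8 * (real n * \<bar>t\<bar>) + 16 * (real n)\<^sup>2"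
      by (simp add: power2_diff power_mult_distrib)
    finally have "real n * \<bar>t\<bar> \<le> 2 * (real n)\<^sup>2 + t\<^sup>2 / 8" by linarith
    then have "exp (real n * \<bar>t\<bar>) \<le> exp (2 * (real n)\<^sup>2) * exp (t\<^sup>2 / 8)"
      by (simp flip: exp_add)
    then have "C * exp (real n * \<bar>t\<bar>) \<le> C * (exp (2 * (real n)\<^sup>2) * exp (t\<^sup>2 / 8))"
      using C(1) by (rule mult_left_mono)
    then show ?thesis using C(2)[of s t] \<open>s \<in> _\<close> that by (simp add: mult.assoc)
  qed
  then show ?thesis using C(1) by (intro exI[of _ "C * exp (2 * (real n)\<^sup>2)"]) auto
qed

text \<open>Together with \<open>hermite_pred_deriv\<close> this makes (h_s, h_{s-1}) a closed
  first-order linear system; the Wronskian and Riccati computations use that form.\<close>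

lemma hermite_deriv': "(hermite s has_real_derivative t * hermite s t - hermite (s - 1) t) (at t)"
  using hermite_deriv[of s t] hermite_pred[of s t] by (simp add: algebra_simps)

lemma hermite_pred_deriv: "(hermite (s - 1) has_real_derivative (1 - s) * hermite s t) (at t)"
  using hermite_deriv[of "s - 1" t] by simp

section \<open>Wronskian and Riccati equation\<close>

text \<open>With t = y + u the exponential equals exp((y^2 - t^2)/2), the Gaussian weight normalised
  at y. The shift fixes the domain of integration, so that \<open>winteg\<close> can be treated by
  dominated convergence in y as well.\<close>

definition wint :: "real \<Rightarrow> real \<Rightarrow> real \<Rightarrow> real \<Rightarrow> real" where
  "wint s s' y u = exp (- u\<^sup>2 / 2 - y * u) * (hermite s (y + u) * hermite s' (y + u))"

definition winteg :: "real \<Rightarrow> real \<Rightarrow> real \<Rightarrow> real" where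
  "winteg s s' y = (\<integral>u. indicator {0<..} u * wint s s' y u \<partial>lborel)"

lemma wint_bound:
  "\<exists>C\<ge>0. \<forall>s s' y u. \<bar>s\<bar> \<le> m \<longrightarrow> \<bar>s'\<bar> \<le> m \<longrightarrow> \<bar>y\<bar> \<le> Y \<longrightarrow> u \<ge> 0 \<longrightarrow> \<bar>wint s s' y u\<bar> \<le> C * exp (- u)"
proof -
  obtain C where C: "C \<ge> 0" "\<And>s t. \<bar>s\<bar> \<le> m \<Longrightarrow> t \<ge> - Y \<Longrightarrow> \<bar>hermite s t\<bar> \<le> C * exp (t\<^sup>2 / 8)"
    using hermite_growth[of m "- Y"] by blast
  \<comment> \<open>Completing the square writes the exponent as y^2/4 + (y/2 - 1)^2 minus a square
    minus u; \<open>K\<close> bounds the first two terms for |y| <= Y.\<close>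
  define K where "K = (Y / 2 + 1)\<^sup>2 + Y\<^sup>2 / 4"
  have "\<bar>wint s s' y u\<bar> \<le> (C * C * exp K) * exp (- u)"
    if *: "\<bar>s\<bar> \<le> m" "\<bar>s'\<bar> \<le> m" "\<bar>y\<bar> \<le> Y" "u \<ge> 0" for s s' y u
  proof -
    have "\<bar>hermite s (y + u)\<bar> * \<bar>hermite s' (y + u)\<bar> \<le> (C * exp ((y + u)\<^sup>2 / 8)) * (C * exp ((y + u)\<^sup>2 / 8))"
      using * C by (intro mult_mono C) auto
    also have "\<dots> = C * C * exp ((y + u)\<^sup>2 / 4)" by (simp flip: exp_add)
    finally have "\<bar>wint s s' y u\<bar> \<le> exp (- u\<^sup>2 / 2 - y * u) * (C * C * exp ((y + u)\<^sup>2 / 4))"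
      unfolding wint_def abs_mult by (simp add: mult_left_mono)
    also have "\<dots> = C * C * exp (- u\<^sup>2 / 2 - y * u + (y + u)\<^sup>2 / 4)" by (simp add: exp_add)
    also have "\<dots> \<le> C * C * exp (K - u)"
    proof -
      have "(y / 2 - 1)\<^sup>2 \<le> (Y / 2 + 1)\<^sup>2"
        using * by (intro abs_le_square_iff[THEN iffD1]) auto
      moreover have "y\<^sup>2 \<le> Y\<^sup>2" using * by (intro abs_le_square_iff[THEN iffD1]) auto
      moreover have "0 \<le> (u / 2 + (y / 2 - 1))\<^sup>2" by simp
      moreover have "- u\<^sup>2 / 2 - y * u + (y + u)\<^sup>2 / 4 = y\<^sup>2 / 4 + (y / 2 - 1)\<^sup>2 - (u / 2 + (y / 2 - 1))\<^sup>2 - u"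
        by (simp add: power2_eq_square field_simps)
      ultimately have "- u\<^sup>2 / 2 - y * u + (y + u)\<^sup>2 / 4 \<le> K - u"
        unfolding K_def by linarith
      then show ?thesis using C(1) by (intro mult_left_mono) auto
    qed
    also have "\<dots> = (C * C * exp K) * exp (- u)" by (simp add: exp_diff exp_minus field_simps)
    finally show ?thesis .
  qed
  then show ?thesis using C(1) by (intro exI[of _ "C * C * exp K"]) auto
qed

lemma wint_continuous: "continuous_on A (wint s s' y)"
  unfolding wint_def by (intro continuous_intros) auto

lemma wint_measurable [measurable]: "wint s s' y \<in> borel_measurable borel"
  by (rule borel_measurable_continuous_onI[OF wint_continuous])

lemma integrable_exp_minus: "integrable lborel (\<lambda>u::real. C * (indicator {0<..} u * exp (- u)))"
proof -
  have e: "indicator {0<..} u * (u powr (1 - 1) * exp (- u)) = indicator {0<..} u * exp (- u)" for u :: real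
    by (auto simp: indicator_def)
  show ?thesis using integrable_powr_exp[of 1] unfolding e by (intro integrable_mult_right) simp
qed

lemma integrable_wint: "integrable lborel (\<lambda>u. indicator {0<..} u * wint s s' y u)"
proof -
  obtain C where C: "C \<ge> 0" "\<And>u. u \<ge> 0 \<Longrightarrow> \<bar>wint s s' y u\<bar> \<le> C * exp (- u)"
    using wint_bound[of "max \<bar>s\<bar> \<bar>s'\<bar>" "\<bar>y\<bar>"] by (metis max.cobounded1 max.cobounded2 order_refl)
  show ?thesis
    by (rule Bochner_Integration.integrable_bound[OF integrable_exp_minus[of C]])
       (use C in \<open>auto simp: indicator_def abs_mult\<close>)
qed

lemma winteg_pos:
  assumes "\<And>t. t \<ge> y \<Longrightarrow> hermite s t > 0" "\<And>t. t \<ge> y \<Longrightarrow> hermite s' t > 0"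
  shows "winteg s s' y > 0"
  unfolding winteg_def by (rule integral_Ioi_pos[OF _ integrable_wint]) (simp add: wint_def assms)

lemma winteg_continuous: "isCont (\<lambda>(s', y). winteg s s' y) p"
proof -
  have box: "continuous_on ({a..b} \<times> {-Y..Y}) (\<lambda>(s', y). winteg s s' y)" for a b Y
  proof -
    define m where "m = \<bar>s\<bar> + \<bar>a\<bar> + \<bar>b\<bar>"
    obtain C where C: "C \<ge> 0" "\<And>s' y u. \<bar>s'\<bar> \<le> m \<Longrightarrow> \<bar>y\<bar> \<le> Y \<Longrightarrow> u \<ge> 0 \<Longrightarrow> \<bar>wint s s' y u\<bar> \<le> C * exp (- u)"
      using wint_bound[of m Y] unfolding m_def by (metis abs_ge_zero add_increasing2 order_refl add.assoc)
    have "continuous_on ({a..b} \<times> {-Y..Y}) (\<lambda>p. \<integral>u. indicator {0<..} u * wint s (fst p) (snd p) u \<partial>lborel)"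
    proof (rule continuous_on_integral_dominated[OF _ _ integrable_exp_minus[of C]])
      show "continuous_on ({a..b} \<times> {-Y..Y}) (\<lambda>p. indicator {0<..} u * wint s (fst p) (snd p) u)" for u :: real
        unfolding wint_def by (intro continuous_intros)
      show "\<bar>indicator {0<..} u * wint s (fst p) (snd p) u\<bar> \<le> C * (indicator {0<..} u * exp (- u))"
        if "p \<in> {a..b} \<times> {-Y..Y}" for p and u :: real
      proof -
        have "\<bar>fst p\<bar> \<le> m" "\<bar>snd p\<bar> \<le> Y" using that by (auto simp: m_def)
        then show ?thesis using C(2)[of "fst p" "snd p" u] by (cases "u > 0") auto
      qed
    qed auto
    then show ?thesis by (simp add: winteg_def case_prod_unfold)
  qed
  have "continuous_on ({fst p - 1<..} \<times> UNIV) (\<lambda>(s', y). winteg s s' y)"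
    by (rule continuous_on_UNIV_from_boxes[OF box])
  then show ?thesis
    by (cases p, subst (asm) continuous_on_eq_continuous_at) (auto intro: open_Times)
qed

lemma tendsto_winteg:
  assumes "(f \<longlongrightarrow> a) F" "(g \<longlongrightarrow> b) F"
  shows "((\<lambda>x. winteg s (f x) (g x)) \<longlongrightarrow> winteg s a b) F"
  using isCont_tendsto_compose[OF winteg_continuous tendsto_Pair[OF assms]] by simp

text \<open>Sturm's argument: the weighted Wronskian of the two systems has derivative (s - s')
  times the weighted product h_s h_{s'} and tends to 0 at infinity, so its value at y is the
  integral over the half line.\<close>

lemma hermite_wronskian:
  "hermite s y * hermite (s' - 1) y - hermite s' y * hermite (s - 1) y = (s' - s) * winteg s s' y"
proof -
  define F where "F u = wint s (s' - 1) y u - wint s' (s - 1) y u" for u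
  have "(\<integral>u. indicator {0<..} u * ((s - s') * wint s s' y u) \<partial>lborel) = - F 0"
  proof (rule integral_Ioi_FTC)
    fix u :: real
    define E where "E = exp (- u\<^sup>2 / 2 - y * u)"
    have wE: "wint s s' y u = E * (hermite s (y + u) * hermite s' (y + u))"
      by (simp add: wint_def E_def)
    have d: "((\<lambda>u. exp (- u\<^sup>2 / 2 - y * u)) has_real_derivative E * (- u - y)) (at u)"
      unfolding E_def by (auto intro!: derivative_eq_intros)
    have c: "((\<lambda>u. y + u) has_real_derivative 1) (at u)"
      by (auto intro!: derivative_eq_intros)
    note h = DERIV_chain2[OF hermite_deriv' c] DERIV_chain2[OF hermite_pred_deriv c]
    have "(F has_real_derivative
       ((E * (- u - y)) * (hermite s (y + u) * hermite (s' - 1) (y + u)) +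
          (((y + u) * hermite s (y + u) - hermite (s - 1) (y + u)) * 1 * hermite (s' - 1) (y + u)
            + (1 - s') * hermite s' (y + u) * 1 * hermite s (y + u)) * E)
       - ((E * (- u - y)) * (hermite s' (y + u) * hermite (s - 1) (y + u)) +
          (((y + u) * hermite s' (y + u) - hermite (s' - 1) (y + u)) * 1 * hermite (s - 1) (y + u)
            + (1 - s) * hermite s (y + u) * 1 * hermite s' (y + u)) * E)) (at u)"
      unfolding F_def wint_def E_def
      by (intro DERIV_diff DERIV_mult h d[unfolded E_def])
    then show "(F has_real_derivative (s - s') * wint s s' y u) (at u)"
      by (rule DERIV_cong) (simp add: wE algebra_simps)
    show "isCont (\<lambda>u. (s - s') * wint s s' y u) u"
      using wint_continuous[of UNIV] by (auto simp: continuous_on_eq_continuous_at intro!: continuous_intros)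
  next
    have "integrable lborel (\<lambda>u. (s - s') * (indicator {0<..} u * wint s s' y u))"
      by (intro integrable_mult_right integrable_wint)
    then show "integrable lborel (\<lambda>u. indicator {0<..} u * ((s - s') * wint s s' y u))"
      by (simp add: mult_ac)
    have "isCont F 0"
      unfolding F_def using wint_continuous[of UNIV]
      by (auto simp: continuous_on_eq_continuous_at intro!: continuous_intros)
    then show "(F \<longlongrightarrow> F 0) (at_right 0)"
      by (simp add: continuous_at filterlim_at_split)
    define m where "m = \<bar>s\<bar> + \<bar>s'\<bar> + 1"
    have m: "\<bar>s\<bar> \<le> m" "\<bar>s'\<bar> \<le> m" "\<bar>s - 1\<bar> \<le> m" "\<bar>s' - 1\<bar> \<le> m" by (auto simp: m_def)
    obtain C where C: "\<And>s s' u. \<bar>s\<bar> \<le> m \<Longrightarrow> \<bar>s'\<bar> \<le> m \<Longrightarrow> u \<ge> 0 \<Longrightarrow> \<bar>wint s s' y u\<bar> \<le> C * exp (- u)"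
      using wint_bound[of m "\<bar>y\<bar>"] by (metis order_refl)
    show "(F \<longlongrightarrow> 0) at_top"
    proof (rule Lim_null_comparison)
      show "\<forall>\<^sub>F u in at_top. norm (F u) \<le> 2 * C * exp (- u)"
        using eventually_ge_at_top[of "0::real"]
      proof eventually_elim
        case (elim u)
        then show ?case
          using C[OF m(1) m(4), of u] C[OF m(2) m(3), of u] by (simp add: F_def)
      qed
      show "((\<lambda>u. 2 * C * exp (- u)) \<longlongrightarrow> 0) at_top" by real_asymp
    qed
  qed
  moreover have "(\<integral>u. indicator {0<..} u * ((s - s') * wint s s' y u) \<partial>lborel) = (s - s') * winteg s s' y"
    unfolding winteg_def by (simp add: mult.left_commute[of _ "s - s'"])
  ultimately have "(s - s') * winteg s s' y = - F 0" by simp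
  then show ?thesis by (simp add: F_def wint_def algebra_simps)
qed

text \<open>Common pattern of the positivity proofs below: multiply by exp(-t^2/2), find a
  derivative of known sign, and compare with the limit 0 at infinity.\<close>

lemma pos_if_decreasing_to_0:
  fixes k :: "real \<Rightarrow> real"
  assumes "\<And>t. t > y \<Longrightarrow> \<exists>d. (k has_real_derivative d) (at t) \<and> d < 0"
    and "continuous_on UNIV k" "(k \<longlongrightarrow> 0) at_top"
  shows "k y > 0"
proof -
  have dec: "k b < k a" if "y \<le> a" "a < b" for a b
    using that assms(1,2)
    by (intro DERIV_neg_imp_decreasing_open[of a b k]) (auto intro: continuous_on_subset)
  have "0 \<le> k (y + 1)"
  proof (rule tendsto_upperbound[OF assms(3)])
    show "\<forall>\<^sub>F t in at_top. k t \<le> k (y + 1)"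
      using eventually_gt_at_top[of "y + 1"]
      by eventually_elim (use dec in \<open>force intro: less_imp_le\<close>)
  qed simp
  also have "\<dots> < k y" by (rule dec) auto
  finally show ?thesis .
qed

lemma hermite_decay:
  assumes "((\<lambda>t. g t * exp (- t\<^sup>2 / 4)) \<longlongrightarrow> 0) at_top"
  shows "((\<lambda>t. exp (- t\<^sup>2 / 2) * (g t * (hermite s t * hermite s' t))) \<longlongrightarrow> 0) at_top"
proof -
  define m where "m = max \<bar>s\<bar> \<bar>s'\<bar>"
  obtain C where C: "C \<ge> 0" "\<And>s t. \<bar>s\<bar> \<le> m \<Longrightarrow> t \<ge> 0 \<Longrightarrow> \<bar>hermite s t\<bar> \<le> C * exp (t\<^sup>2 / 8)"
    using hermite_growth[of m 0] by auto
  show ?thesis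
  proof (rule Lim_null_comparison)
    have "norm (exp (- t\<^sup>2 / 2) * (g t * (hermite s t * hermite s' t))) \<le> C * C * \<bar>g t * exp (- t\<^sup>2 / 4)\<bar>"
      if "t \<ge> 0" for t
    proof -
      have "\<bar>hermite s t\<bar> * \<bar>hermite s' t\<bar> \<le> (C * exp (t\<^sup>2 / 8)) * (C * exp (t\<^sup>2 / 8))"
        using C(1) that by (intro mult_mono C(2)) (auto simp: m_def)
      also have "\<dots> = C * C * exp (t\<^sup>2 / 4)" by (simp flip: exp_add)
      finally have "(exp (- t\<^sup>2 / 2) * \<bar>g t\<bar>) * (\<bar>hermite s t\<bar> * \<bar>hermite s' t\<bar>)
          \<le> (exp (- t\<^sup>2 / 2) * \<bar>g t\<bar>) * (C * C * exp (t\<^sup>2 / 4))"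
        by (rule mult_left_mono) simp
      also have "\<dots> = C * C * (\<bar>g t\<bar> * (exp (- t\<^sup>2 / 2) * exp (t\<^sup>2 / 4)))" by simp
      also have "exp (- t\<^sup>2 / 2) * exp (t\<^sup>2 / 4) = exp (- t\<^sup>2 / 4)" by (simp flip: exp_add)
      finally show ?thesis by (simp add: abs_mult mult_ac)
    qed
    then show "\<forall>\<^sub>F t in at_top. norm (exp (- t\<^sup>2 / 2) * (g t * (hermite s t * hermite s' t))) \<le> C * C * \<bar>g t * exp (- t\<^sup>2 / 4)\<bar>"
      using eventually_ge_at_top[of "0::real"] by (rule eventually_mono[rotated])
    show "((\<lambda>t. C * C * \<bar>g t * exp (- t\<^sup>2 / 4)\<bar>) \<longlongrightarrow> 0) at_top"
      using tendsto_mult_right_zero[OF tendsto_rabs_zero[OF assms]] .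
  qed
qed

lemma hermite_decay_1: "((\<lambda>t. exp (- t\<^sup>2 / 2) * (hermite s t * hermite s' t)) \<longlongrightarrow> 0) at_top"
proof -
  have "((\<lambda>t::real. 1 * exp (- t\<^sup>2 / 4)) \<longlongrightarrow> 0) at_top" by real_asymp
  from hermite_decay[OF this] show ?thesis by simp
qed

text \<open>By the recurrence, exp(-t^2/2) h_{s+1} has derivative -exp(-t^2/2) h_s.\<close>

lemma hermite_succ_pos:
  assumes "\<And>t. t > y \<Longrightarrow> hermite s t > 0"
  shows "hermite (s + 1) y > 0"
proof -
  define k where "k t = exp (- t\<^sup>2 / 2) * hermite (s + 1) t" for t
  have "k y > 0"
  proof (rule pos_if_decreasing_to_0[of y k])
    fix t assume t: "t > y"
    define E where "E = exp (- t\<^sup>2 / 2)"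
    have d: "((\<lambda>t. exp (- t\<^sup>2 / 2)) has_real_derivative E * (- t)) (at t)"
      unfolding E_def by (auto intro!: derivative_eq_intros)
    have "(k has_real_derivative E * (- t) * hermite (s + 1) t + - (s + 1) * hermite (s + 1 + 1) t * E) (at t)"
      unfolding k_def E_def by (intro DERIV_mult hermite_deriv d[unfolded E_def])
    moreover have "E * (- t) * hermite (s + 1) t + - (s + 1) * hermite (s + 1 + 1) t * E = - (E * hermite s t)"
      using hermite_rec[of s t] by (simp add: algebra_simps add.assoc)
    moreover have "- (E * hermite s t) < 0" using assms[OF t] by (simp add: E_def)
    ultimately show "\<exists>d. (k has_real_derivative d) (at t) \<and> d < 0" by metis
  next
    show "continuous_on UNIV k" unfolding k_def by (intro continuous_intros) auto
    \<comment> \<open>Inserting the constant \<open>hermite 0\<close> turns a single Hermite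
      function into a product covered by \<open>hermite_decay_1\<close>.\<close>
    have c: "hermite 0 t = hermite 0 0" for t by (rule hermite_zero_const)
    have "((\<lambda>t. exp (- t\<^sup>2 / 2) * (hermite (s + 1) t * hermite 0 t) / hermite 0 0) \<longlongrightarrow> 0 / hermite 0 0) at_top"
      using hermite_pos[of 0 0] by (intro tendsto_divide hermite_decay_1) auto
    then show "(k \<longlongrightarrow> 0) at_top"
      unfolding k_def using hermite_pos[of 0 0] by (subst (asm) c) simp
  qed
  then show ?thesis by (simp add: k_def zero_less_mult_iff)
qed

text \<open>An interior zero of a nonnegative function is a minimum, so -s h_{s+1} vanishes there
  too, which \<open>hermite_no_double_zero\<close> excludes.\<close>

lemma hermite_pos_of_nonneg:
  assumes "\<And>t. t > y \<Longrightarrow> hermite s t \<ge> 0" "t > y"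
  shows "hermite s t > 0"
proof (rule ccontr)
  assume "\<not> hermite s t > 0"
  then have z: "hermite s t = 0" using assms(1)[OF assms(2)] by auto
  then have "s \<noteq> 0" using hermite_pos[of 0 t] by auto
  have "- s * hermite (s + 1) t = 0"
  proof (rule DERIV_local_min[OF hermite_deriv])
    show "0 < t - y" using assms by simp
    show "\<forall>x. \<bar>t - x\<bar> < t - y \<longrightarrow> hermite s t \<le> hermite s x"
    proof (intro allI impI)
      fix x assume "\<bar>t - x\<bar> < t - y"
      then have "x > y" by linarith
      then show "hermite s t \<le> hermite s x" using z assms(1) by simp
    qed
  qed
  then show False using z \<open>s \<noteq> 0\<close> hermite_no_double_zero[of s t] by simp
qed

text \<open>The expression is h_s^2 times the right-hand side of the Riccati equation for h_{s-1} /
  h_s. Its product with exp(-t^2/2) has derivative -exp(-t^2/2) h_s h_{s-1}, and h_{s-1} stays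
  positive to the right of y because it increases with slope (1 - s) h_s.\<close>

lemma hermite_riccati_pos:
  assumes pos: "\<And>t. t \<ge> y \<Longrightarrow> hermite s t > 0" and s: "s < 1" and F: "hermite (s - 1) y \<ge> 0"
  shows "(1 - s) * (hermite s y)\<^sup>2 + (hermite (s - 1) y)\<^sup>2 - y * (hermite s y * hermite (s - 1) y) > 0"
proof -
  define k where "k t = exp (- t\<^sup>2 / 2) *
    ((1 - s) * (hermite s t * hermite s t) + hermite (s - 1) t * hermite (s - 1) t - t * (hermite s t * hermite (s - 1) t))" for t
  have Fpos: "hermite (s - 1) t > 0" if "t > y" for t
  proof -
    have "hermite (s - 1) y < hermite (s - 1) t"
    proof (rule DERIV_pos_imp_increasing[OF that])
      fix x assume "y \<le> x" "x \<le> t"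
      then have "(1 - s) * hermite s x > 0" using pos s by simp
      then show "\<exists>d. (hermite (s - 1) has_real_derivative d) (at x) \<and> d > 0"
        using hermite_pred_deriv by blast
    qed
    then show ?thesis using F by simp
  qed
  have "k y > 0"
  proof (rule pos_if_decreasing_to_0[of y k])
    fix t assume t: "t > y"
    define E where "E = exp (- t\<^sup>2 / 2)"
    have d: "((\<lambda>t. exp (- t\<^sup>2 / 2)) has_real_derivative E * (- t)) (at t)"
      unfolding E_def by (auto intro!: derivative_eq_intros)
    note J = hermite_deriv'[of s t] and G = hermite_pred_deriv[of s t]
    note N = DERIV_diff[OF DERIV_add[OF DERIV_cmult[OF DERIV_mult[OF J J], of "1 - s"] DERIV_mult[OF G G]]
        DERIV_mult[OF DERIV_ident DERIV_mult[OF J G]]]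
    from DERIV_mult[OF d N] have "(k has_real_derivative - (E * (hermite s t * hermite (s - 1) t))) (at t)"
      unfolding k_def E_def [symmetric] by (rule DERIV_cong) (simp add: algebra_simps)
    moreover have "- (E * (hermite s t * hermite (s - 1) t)) < 0"
      using Fpos[OF t] pos[of t] t by (simp add: E_def)
    ultimately show "\<exists>d. (k has_real_derivative d) (at t) \<and> d < 0" by blast
  next
    show "continuous_on UNIV k" unfolding k_def by (intro continuous_intros) auto
    have g: "((\<lambda>t::real. t * exp (- t\<^sup>2 / 4)) \<longlongrightarrow> 0) at_top" by real_asymp
    have "((\<lambda>t. (1 - s) * (exp (- t\<^sup>2 / 2) * (hermite s t * hermite s t))
        + exp (- t\<^sup>2 / 2) * (hermite (s - 1) t * hermite (s - 1) t)
        - exp (- t\<^sup>2 / 2) * (t * (hermite s t * hermite (s - 1) t))) \<longlongrightarrow> (1 - s) * 0 + 0 - 0) at_top"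
      by (intro tendsto_diff tendsto_add tendsto_mult[OF tendsto_const] hermite_decay_1 hermite_decay[OF g])
    then show "(k \<longlongrightarrow> 0) at_top"
      by (simp add: k_def [abs_def] algebra_simps)
  qed
  then show ?thesis by (simp add: k_def zero_less_mult_iff power2_eq_square)
qed

text \<open>Beyond \<open>T\<close> positivity holds uniformly for all indices at least s - 1 by
  \<open>hermite_large_pos\<close>. The remaining segment is compact and hence has positive distance
  from the closed set where \<open>hermite\<close> is nonpositive.\<close>

lemma hermite_pos_open:
  assumes "\<And>t. t \<ge> y \<Longrightarrow> hermite s t > 0"
  shows "\<exists>e>0. \<forall>s'. \<bar>s' - s\<bar> < e \<longrightarrow> (\<forall>t\<ge>y. hermite s' t > 0)"
proof -
  obtain n :: nat where n: "1 - s \<le> real n" using real_arch_simple by blast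
  define T where "T = max y (2 * sqrt (real n) + 1)"
  have large: "hermite s' t > 0" if "t \<ge> T" "s' \<ge> s - 1" for s' t
  proof -
    have "sqrt (real n) \<ge> 0" by simp
    moreover have "t \<ge> 2 * sqrt (real n) + 1" using that by (simp add: T_def)
    ultimately have "t \<ge> 2 * sqrt (real n)" "t > 0" by linarith+
    then have "t\<^sup>2 \<ge> (2 * sqrt (real n))\<^sup>2" by (intro power_mono) auto
    then have "t\<^sup>2 \<ge> 4 * real n" by (simp add: power_mult_distrib)
    then show ?thesis using hermite_large_pos[of t n s'] \<open>t > 0\<close> that n by auto
  qed
  have "\<exists>d>0. \<forall>p\<in>{s} \<times> {y..T}. \<forall>q\<in>{q. hermite (fst q) (snd q) \<le> 0}. d \<le> dist p q"
  proof (rule separate_compact_closed)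
    show "compact ({s} \<times> {y..T})" by (intro compact_Times) auto
    show "closed {q. hermite (fst q) (snd q) \<le> 0}" by (intro closed_Collect_le continuous_intros)
    show "{s} \<times> {y..T} \<inter> {q. hermite (fst q) (snd q) \<le> 0} = {}" using assms by force
  qed
  then obtain d where d: "d > 0"
    "\<And>p q. p \<in> {s} \<times> {y..T} \<Longrightarrow> hermite (fst q) (snd q) \<le> 0 \<Longrightarrow> d \<le> dist p q" by blast
  have "hermite s' t > 0" if "\<bar>s' - s\<bar> < min d 1" "t \<ge> y" for s' t
  proof (cases "t \<ge> T")
    case True
    then show ?thesis using large[of t s'] that by auto
  next
    case False
    then have "dist (s, t) (s', t) < d" using that by (simp add: dist_Pair_Pair dist_real_def abs_minus_commute)
    then show ?thesis using d(2)[of "(s, t)" "(s', t)"] that False by force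
  qed
  then show ?thesis using d(1) by (intro exI[of _ "min d 1"]) auto
qed

section \<open>The matching condition\<close>

text \<open>
  The slopes of the drift are \<open>-c\<close> on the left and \<open>-d\<close> on the right; keeping both makes the problem
  symmetric under reflection, so that one may assume \<open>d \<le> c\<close>. The index \<open>1 - l / c\<close> belongs to \<open>f'\<close> and
  the index \<open>- (l / c)\<close> to \<open>f\<close>.
\<close>

definition matching :: "real \<Rightarrow> real \<Rightarrow> real \<Rightarrow> real \<Rightarrow> real" where
  "matching c d b l =
     sqrt c * hermite (- (l / c)) (- (b / sqrt c)) * hermite (1 - l / d) (b / sqrt d)
     + sqrt d * hermite (- (l / d)) (b / sqrt d) * hermite (1 - l / c) (- (b / sqrt c))"

text \<open>A level \<open>l\<close> with a solution decaying at both ends whose derivative f' is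
  positive. \<open>matching\<close> is cleared of denominators, so it stays continuous at zeros of
  the Hermite functions; under the positivity required here, its vanishing says that f / f' agrees
  from both sides.\<close>

definition ground :: "real \<Rightarrow> real \<Rightarrow> real \<Rightarrow> real \<Rightarrow> bool" where
  "ground c d b l \<longleftrightarrow> l > 0 \<and> (\<forall>t\<ge>- (b / sqrt c). hermite (1 - l / c) t > 0) \<and>
     (\<forall>t\<ge>b / sqrt d. hermite (1 - l / d) t > 0) \<and> matching c d b l = 0"

lemma ground_reflect: "ground c d (- b) l \<longleftrightarrow> ground d c b l"
  by (auto simp: ground_def matching_def)

text \<open>Applying the recurrence to the lower indices produces two terms with factors -b and b
  that cancel. In what remains the signs of 1 - l/c and 1 - l/d are visible, which decides the sign
  of \<open>matching\<close> at l = d and l = c.\<close>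

lemma matching_alt:
  assumes "c > 0" "d > 0"
  shows "matching c d b l =
    sqrt c * ((1 - l / c) * hermite (2 - l / c) (- (b / sqrt c))) * hermite (1 - l / d) (b / sqrt d)
    + sqrt d * ((1 - l / d) * hermite (2 - l / d) (b / sqrt d)) * hermite (1 - l / c) (- (b / sqrt c))"
proof -
  have *: "hermite (- x) y = y * hermite (1 - x) y + (1 - x) * hermite (2 - x) y" for x y
    using hermite_rec[of "- x" y] by simp
  have "sqrt c * (- (b / sqrt c)) = - b" "sqrt d * (b / sqrt d) = b"
    using assms by auto
  then have "matching c d b l =
     (- b * hermite (1 - l / c) (- (b / sqrt c)) + sqrt c * ((1 - l / c) * hermite (2 - l / c) (- (b / sqrt c)))) * hermite (1 - l / d) (b / sqrt d)
     + (b * hermite (1 - l / d) (b / sqrt d) + sqrt d * ((1 - l / d) * hermite (2 - l / d) (b / sqrt d))) * hermite (1 - l / c) (- (b / sqrt c))"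
    unfolding matching_def *[of "l / c"] *[of "l / d"] distrib_left mult.assoc[symmetric] by simp
  then show ?thesis by (simp add: algebra_simps)
qed

lemma tendsto_matching:
  assumes "c > 0" "d > 0" "(b \<longlongrightarrow> b0) F" "(l \<longlongrightarrow> l0) F"
  shows "((\<lambda>x. matching c d (b x) (l x)) \<longlongrightarrow> matching c d b0 l0) F"
  unfolding matching_def using assms by (intro tendsto_intros) auto

text \<open>Away from the end point this is \<open>hermite_pos_of_nonneg\<close>. A zero at the end
  point would remove the first term of \<open>matching_alt\<close> and leave a negative one, against
  the hypothesis on \<open>matching\<close>.\<close>

lemma hermite_pos_of_limit:
  assumes cd: "0 < d" "d \<le> c" "l \<in> {d..c}"
    and nonneg: "\<And>t. t > b / sqrt d \<Longrightarrow> hermite (1 - l / d) t \<ge> 0"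
    and m: "matching c d b l \<ge> 0"
    and t: "t \<ge> b / sqrt d"
  shows "hermite (1 - l / d) t > 0"
proof -
  define y where "y = b / sqrt d"
  have pos: "hermite (1 - l / d) t > 0" if "t > y" for t
    using hermite_pos_of_nonneg[of y "1 - l / d" t] nonneg that by (simp add: y_def)
  have lim: "hermite (1 - l / d) y \<ge> 0"
  proof (rule tendsto_lowerbound[of "hermite (1 - l / d)" _ "at_right y"])
    show "(hermite (1 - l / d) \<longlongrightarrow> hermite (1 - l / d) y) (at_right y)"
      by (intro tendsto_intros)
    show "\<forall>\<^sub>F t in at_right y. 0 \<le> hermite (1 - l / d) t"
      using pos by (auto simp: eventually_at_filter less_imp_le intro!: always_eventually)
  qed simp
  have "hermite (1 - l / d) y \<noteq> 0"
  proof
    assume z: "hermite (1 - l / d) y = 0"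
    then have "1 - l / d \<noteq> 0" using hermite_pos[of 0 y] by auto
    then have "1 - l / d < 0" using cd by (auto simp: field_simps)
    moreover have "hermite (2 - l / d) y > 0"
      using hermite_succ_pos[of y "1 - l / d"] pos by (simp add: algebra_simps)
    moreover have "hermite (1 - l / c) (- (b / sqrt c)) > 0"
      using cd by (intro hermite_pos) (auto simp: field_simps)
    ultimately have "sqrt d * ((1 - l / d) * hermite (2 - l / d) y) * hermite (1 - l / c) (- (b / sqrt c)) < 0"
      using cd by (intro mult_neg_pos mult_pos_neg) auto
    then show False
      using m z cd unfolding y_def by (subst (asm) matching_alt) auto
  qed
  then show ?thesis using pos[of t] t lim by (cases "t = y") (auto simp: y_def)
qed

text \<open>
  The root is the supremum of the levels with a positive solution and a nonnegative matching function.
  Positivity survives in the limit: a zero could only appear at the end point, but there the matching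
  function would be negative.
\<close>

lemma ground_exists:
  assumes cd: "0 < d" "d \<le> c"
  shows "\<exists>l\<in>{d..c}. ground c d b l"
proof -
  define y where "y = b / sqrt d"
  define S where "S = {l \<in> {d..c}. (\<forall>t\<ge>y. hermite (1 - l / d) t > 0) \<and> matching c d b l \<ge> 0}"
  have left: "hermite (1 - l / c) t > 0" "hermite (2 - l / c) t > 0" if "l \<in> {d..c}" for l t
    using that cd by (auto intro!: hermite_pos simp: field_simps)
  \<comment> \<open>At l = d the right index is 0, so the Hermite function there is positive and
    only the nonnegative left term of \<open>matching_alt\<close> remains.\<close>
  have "d \<in> S"
  proof -
    have "matching c d b d = sqrt c * ((1 - d / c) * hermite (2 - d / c) (- (b / sqrt c))) * hermite 0 (b / sqrt d)"
      using cd by (simp add: matching_alt)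
    moreover have "\<dots> \<ge> 0" 
      using cd left[of d] by (intro mult_nonneg_nonneg) (auto simp: field_simps less_imp_le hermite_pos)
    ultimately show ?thesis using cd by (simp add: S_def hermite_pos)
  qed
  define l where "l = Sup S"
  \<comment> \<open>\<open>K\<close> relaxes \<open>S\<close> to weak inequalities; it is closed and
    therefore contains the supremum of \<open>S\<close>.\<close>
  define K where "K = {l \<in> {d..c}. (\<forall>t\<in>{y..}. hermite (1 - l / d) t \<ge> 0) \<and> matching c d b l \<ge> 0}"
  have "closed ({d..c} \<inter> (\<Inter>t\<in>{y..}. {l. hermite (1 - l / d) t \<ge> 0}) \<inter> {l. matching c d b l \<ge> 0})"
    unfolding matching_def using cd
    by (intro closed_Int closed_INT ballI closed_Collect_le closed_atLeastAtMost continuous_intros) auto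
  also have "{d..c} \<inter> (\<Inter>t\<in>{y..}. {l. hermite (1 - l / d) t \<ge> 0}) \<inter> {l. matching c d b l \<ge> 0} = K"
    by (auto simp: K_def)
  finally have "closed K" .
  moreover have "S \<subseteq> K" by (auto simp: S_def K_def less_imp_le)
  moreover have bdd: "bdd_above S" by (rule bdd_aboveI[of _ c]) (auto simp: S_def)
  ultimately have "l \<in> K"
    unfolding l_def using \<open>d \<in> S\<close> by (intro closed_subset_contains_Sup) auto
  then have l: "l \<in> {d..c}" "matching c d b l \<ge> 0" "\<And>t. t \<ge> y \<Longrightarrow> hermite (1 - l / d) t \<ge> 0"
    by (auto simp: K_def)
  have pos: "hermite (1 - l / d) t > 0" if "t \<ge> y" for t
    using hermite_pos_of_limit[OF cd l(1) _ l(2)] l(3) that by (auto simp: y_def)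
  have "\<not> matching c d b l > 0"
  proof
    assume m: "matching c d b l > 0"
    \<comment> \<open>At l = c the left index is 0 and only the right term of
      \<open>matching_alt\<close> remains, which is nonpositive since d <= c.\<close>
    have "l \<noteq> c"
    proof
      assume "l = c"
      then have "matching c d b l = sqrt d * ((1 - c / d) * hermite (2 - c / d) y) * hermite 0 (- (b / sqrt c))"
        using cd by (simp add: matching_alt y_def)
      moreover have "hermite (2 - c / d) y > 0"
        using hermite_succ_pos[of y "1 - l / d"] pos \<open>l = c\<close> by (simp add: algebra_simps)
      then have "(1 - c / d) * hermite (2 - c / d) y \<le> 0"
        using cd by (intro mult_nonpos_nonneg) auto
      then have "sqrt d * ((1 - c / d) * hermite (2 - c / d) y) * hermite 0 (- (b / sqrt c)) \<le> 0"
        using cd hermite_pos[of 0 "- (b / sqrt c)"]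
        by (intro mult_nonpos_nonneg[OF mult_nonneg_nonpos]) (auto simp: less_imp_le)
      ultimately show False using m by simp
    qed
    then have "l < c" using l by auto
    \<comment> \<open>Both strict inequalities persist slightly to the right of \<open>l\<close>,
      which puts a larger level into \<open>S\<close>.\<close>
    obtain e where e: "e > 0" "\<And>s' t. \<bar>s' - (1 - l / d)\<bar> < e \<Longrightarrow> t \<ge> y \<Longrightarrow> hermite s' t > 0"
      using hermite_pos_open[of y "1 - l / d"] pos by blast
    have "((\<lambda>l'. matching c d b l') \<longlongrightarrow> matching c d b l) (at_right l)"
      using cd by (intro tendsto_matching tendsto_intros) auto
    then have "\<forall>\<^sub>F l' in at_right l. matching c d b l' > 0"
      using m by (rule order_tendstoD)
    moreover have "\<forall>\<^sub>F l' in at_right l. l' \<in> {l<..<min c (l + e * d)}"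
      using \<open>l < c\<close> e(1) cd by (intro eventually_at_right_real) auto
    ultimately have "\<forall>\<^sub>F l' in at_right l. l' \<in> S \<and> l' > l"
    proof eventually_elim
      case (elim l')
      have "\<bar>(1 - l' / d) - (1 - l / d)\<bar> = \<bar>(l' - l) / d\<bar>"
        by (simp add: diff_divide_distrib abs_minus_commute)
      also have "\<dots> = (l' - l) / d" using elim cd by simp
      also have "(l' - l) / d < e" using elim cd by (simp add: field_simps)
      finally show ?case using elim e(2) l by (auto simp: S_def)
    qed
    then obtain l' where "l' \<in> S" "l' > l"
      using eventually_happens[of _ "at_right l"] by force
    then show False using cSup_upper[OF _ bdd, of l'] by (simp add: l_def)
  qed
  then have "matching c d b l = 0" using l by simp
  then have "ground c d b l"
    using l(1) pos left(1)[OF l(1)] cd by (auto simp: ground_def y_def)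
  then show ?thesis using l(1) by blast
qed

text \<open>Levels in [d, c] have left index 1 - l/c >= 0, so positivity on the left is automatic.
  On the right only a weak inequality survives the limit, and \<open>hermite_pos_of_limit\<close>
  sharpens it.\<close>

lemma ground_limit:
  assumes cd: "0 < d" "d \<le> c"
    and g: "\<And>n. l n \<in> {d..c} \<and> ground c d (b n) (l n)"
    and lim: "b \<longlonglongrightarrow> b0" "l \<longlonglongrightarrow> l0"
  shows "ground c d b0 l0"
proof -
  have l0: "l0 \<in> {d..c}"
    using closed_sequentially[OF closed_atLeastAtMost, of l d c l0] g lim by blast
  have m: "matching c d b0 l0 = 0"
  proof -
    have "(\<lambda>n. matching c d (b n) (l n)) \<longlonglongrightarrow> matching c d b0 l0"
      using cd lim by (intro tendsto_matching) auto
    moreover have "(\<lambda>n. matching c d (b n) (l n)) = (\<lambda>n. 0)"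
      using g by (auto simp: ground_def)
    ultimately show ?thesis by (simp add: LIMSEQ_const_iff)
  qed
  have nonneg: "hermite (1 - l0 / d) t \<ge> 0" if t: "t > b0 / sqrt d" for t
  proof (rule tendsto_lowerbound)
    show "(\<lambda>n. hermite (1 - l n / d) t) \<longlonglongrightarrow> hermite (1 - l0 / d) t"
      using cd lim by (intro tendsto_intros) auto
    have "(\<lambda>n. b n / sqrt d) \<longlonglongrightarrow> b0 / sqrt d"
      using cd lim by (intro tendsto_intros) auto
    then have "\<forall>\<^sub>F n in sequentially. b n / sqrt d < t" using t by (rule order_tendstoD)
    then show "\<forall>\<^sub>F n in sequentially. 0 \<le> hermite (1 - l n / d) t"
      by eventually_elim (use g in \<open>auto simp: ground_def less_imp_le\<close>)
  qed simp
  have "hermite (1 - l0 / d) t > 0" if "t \<ge> b0 / sqrt d" for t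
    by (rule hermite_pos_of_limit[OF cd l0 nonneg _ that]) (use m in auto)
  moreover have "hermite (1 - l0 / c) t > 0" for t
    using l0 cd by (intro hermite_pos) (auto simp: field_simps)
  ultimately show ?thesis using m l0 cd by (auto simp: ground_def)
qed

section \<open>Eigenfunctions\<close>

definition drift :: "real \<Rightarrow> real \<Rightarrow> real \<Rightarrow> real" where
  "drift b h x = - b - (if x < 0 then x else h * x)"

text \<open>This is exp(A/2) for the antiderivative A of \<open>drift\<close> with A(0) = 0, the
  square root of the unnormalised stationary density.\<close>

definition weight :: "real \<Rightarrow> real \<Rightarrow> real \<Rightarrow> real" where
  "weight b h x = (if x < 0 then exp (- b * x / 2 - x\<^sup>2 / 4) else exp (- b * x / 2 - h * x\<^sup>2 / 4))"

lemma DERIV_glue: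
  fixes g h :: "real \<Rightarrow> real"
  assumes g: "\<And>x. x \<le> 0 \<Longrightarrow> (g has_real_derivative g' x) (at x)"
    and h: "\<And>x. x \<ge> 0 \<Longrightarrow> (h has_real_derivative h' x) (at x)"
    and eq: "g 0 = h 0" "g' 0 = h' 0"
  shows "((\<lambda>x. if x < 0 then g x else h x) has_real_derivative (if x < 0 then g' x else h' x)) (at x)"
proof -
  let ?f = "\<lambda>x. if x < 0 then g x else h x"
  consider "x < 0" | "x > 0" | "x = 0" by linarith
  then show ?thesis
  proof cases
    case 1
    have "(?f has_real_derivative g' x) (at x)"
      by (rule has_field_derivative_transform_within_open[OF g, of _ "{..<0}"]) (use 1 in auto)
    then show ?thesis using 1 by simp
  next
    case 2
    have "(?f has_real_derivative h' x) (at x)"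
      by (rule has_field_derivative_transform_within_open[OF h, of _ "{0<..}"]) (use 2 in auto)
    then show ?thesis using 2 by simp
  next
    case 3
    have "((\<lambda>y. (?f y - ?f 0) / (y - 0)) \<longlongrightarrow> h' 0) (at 0)"
    proof (rule filterlim_split_at)
      have "((\<lambda>y. (g y - g 0) / (y - 0)) \<longlongrightarrow> h' 0) (at_left 0)"
        using g[of 0] eq(2) by (simp add: has_field_derivative_iff filterlim_at_split)
      then show "((\<lambda>y. (?f y - ?f 0) / (y - 0)) \<longlongrightarrow> h' 0) (at_left 0)"
        by (rule Lim_transform_eventually) (auto simp: eventually_at_filter eq(1))
      have "((\<lambda>y. (h y - h 0) / (y - 0)) \<longlongrightarrow> h' 0) (at_right 0)"
        using h[of 0] by (simp add: has_field_derivative_iff filterlim_at_split)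
      then show "((\<lambda>y. (?f y - ?f 0) / (y - 0)) \<longlongrightarrow> h' 0) (at_right 0)"
        by (rule Lim_transform_eventually) (auto simp: eventually_at_filter)
    qed
    then show ?thesis using 3 by (simp add: has_field_derivative_iff)
  qed
qed

lemma weight_pos: "weight b h x > 0"
  by (simp add: weight_def)

lemma weight_deriv: "(weight b h has_real_derivative drift b h x / 2 * weight b h x) (at x)"
proof -
  have "((\<lambda>x. if x < 0 then exp (- b * x / 2 - x\<^sup>2 / 4) else exp (- b * x / 2 - h * x\<^sup>2 / 4)) has_real_derivative
     (if x < 0 then exp (- b * x / 2 - x\<^sup>2 / 4) * (- b / 2 - x / 2)
      else exp (- b * x / 2 - h * x\<^sup>2 / 4) * (- b / 2 - h * x / 2))) (at x)"
    by (rule DERIV_glue) (auto intro!: derivative_eq_intros)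
  then show ?thesis
    unfolding weight_def [abs_def] by (rule DERIV_cong) (auto simp: drift_def field_simps)
qed

lemma drift_isCont: "isCont (drift b h) x"
proof -
  have "drift b h = (\<lambda>x. - b - (min x 0 + h * max x 0))"
    by (auto simp: drift_def)
  then show ?thesis by (auto intro!: continuous_intros)
qed

lemma drift_deriv:
  assumes "x \<noteq> 0"
  shows "(drift b h has_real_derivative (if x < 0 then -1 else - h)) (at x)"
proof (cases "x < 0")
  case True
  have "((\<lambda>x. - b - x) has_real_derivative -1) (at x)" by (auto intro!: derivative_eq_intros)
  then have "(drift b h has_real_derivative -1) (at x)"
    by (rule has_field_derivative_transform_within_open[of _ _ _ "{..<0}"]) (use True in \<open>auto simp: drift_def\<close>)
  then show ?thesis using True by simp
next
  case False
  have "((\<lambda>x. - b - h * x) has_real_derivative - h) (at x)" by (auto intro!: derivative_eq_intros)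
  then have "(drift b h has_real_derivative - h) (at x)"
    by (rule has_field_derivative_transform_within_open[of _ _ _ "{0<..}"]) (use False assms in \<open>auto simp: drift_def\<close>)
  then show ?thesis using False by simp
qed

text \<open>Off 0 the potential is a^2/4 + a'/2 + 1/2. The first two terms are what conjugation of
  f'' + a f' by exp(A/2) produces, and the 1/2 cancels the shift in the eigenvalue equation.\<close>

lemma potential_drift:
  "x \<noteq> 0 \<Longrightarrow> potential b h x = (drift b h x)\<^sup>2 / 4 + (if x < 0 then -1 else - h) / 2 + 1 / 2"
  by (simp add: potential_def drift_def power2_eq_square field_simps)

lemma hermite_side_decay:
  assumes k: "k > 0"
  shows "\<exists>C\<ge>0. \<forall>z\<ge>0. exp (- b * z / 2 - k * z\<^sup>2 / 4) * \<bar>hermite s ((b + k * z) / sqrt k)\<bar> \<le> C * exp (- (k / 16) * z\<^sup>2)"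
proof -
  obtain C where C: "C \<ge> 0" "\<And>t. t \<ge> b / sqrt k \<Longrightarrow> \<bar>hermite s t\<bar> \<le> C * exp (t\<^sup>2 / 8)"
    using hermite_growth[of "\<bar>s\<bar>" "b / sqrt k"] by auto
  define K where "K = b\<^sup>2 / (4 * k) + b\<^sup>2 / (8 * k)"
  have "exp (- b * z / 2 - k * z\<^sup>2 / 4) * \<bar>hermite s ((b + k * z) / sqrt k)\<bar> \<le> (C * exp K) * exp (- (k / 16) * z\<^sup>2)"
    if "z \<ge> 0" for z
  proof -
    have sq: "((b + k * z) / sqrt k)\<^sup>2 = (b + k * z)\<^sup>2 / k"
      using k by (simp add: power_divide)
    have "b / sqrt k \<le> (b + k * z) / sqrt k" using that k by (intro divide_right_mono) auto
    from C(2)[OF this] have "exp (- b * z / 2 - k * z\<^sup>2 / 4) * \<bar>hermite s ((b + k * z) / sqrt k)\<bar>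
        \<le> exp (- b * z / 2 - k * z\<^sup>2 / 4) * (C * exp ((b + k * z)\<^sup>2 / k / 8))"
      unfolding sq by (rule mult_left_mono) simp
    also have "\<dots> = C * exp (- b * z / 2 - k * z\<^sup>2 / 4 + (b + k * z)\<^sup>2 / k / 8)"
      by (simp add: exp_add)
    also have "\<dots> \<le> C * exp (K + - (k / 16) * z\<^sup>2)"
    proof -
      have "- b * z / 2 - k * z\<^sup>2 / 4 + (b + k * z)\<^sup>2 / k / 8
          = K + - (k / 16) * z\<^sup>2 - (2 * b + k * z)\<^sup>2 / (16 * k)"
        using k unfolding K_def by (simp add: field_simps power2_eq_square)
      moreover have "(2 * b + k * z)\<^sup>2 / (16 * k) \<ge> 0" using k by simp
      ultimately have "- b * z / 2 - k * z\<^sup>2 / 4 + (b + k * z)\<^sup>2 / k / 8 \<le> K + - (k / 16) * z\<^sup>2"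
        by linarith
      then show ?thesis using C(1) by (intro mult_left_mono) auto
    qed
    also have "\<dots> = (C * exp K) * exp (- (k / 16) * z\<^sup>2)" by (simp only: exp_add mult.assoc)
    finally show ?thesis .
  qed
  then show ?thesis using C(1) by (intro exI[of _ "C * exp K"]) auto
qed

text \<open>Both branches solve f'' + a f' = -l f and decay after weighting. Since the drift is
  continuous at 0, equality of f and of p at 0 also makes the derivatives of p agree there, so the
  glued p is differentiable everywhere.\<close>

lemma ground_pair:
  assumes h: "h > 0" and g: "ground 1 h b l"
  obtains f p C d where
    "\<And>x. (f has_real_derivative p x) (at x)"
    "\<And>x. (p has_real_derivative - drift b h x * p x - l * f x) (at x)"
    "\<And>x. p x > 0" "d > 0" "C \<ge> 0"
    "\<And>x. weight b h x * \<bar>f x\<bar> \<le> C * exp (- d * x\<^sup>2)"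
    "\<And>x. weight b h x * \<bar>p x\<bar> \<le> C * exp (- d * x\<^sup>2)"
proof -
  define y where "y x = (b + h * x) / sqrt h" for x
  \<comment> \<open>Each branch is scaled by the boundary Hermite value of the opposite side. This
    makes p continuous at 0 by construction and turns continuity of f into \<open>matching\<close> =
    0. The factor sqrt h in \<open>fr\<close> pairs with the slope sqrt h of
    \<open>y\<close>.\<close>
  define pR where "pR = hermite (1 - l / h) (b / sqrt h)"
  define pL where "pL = hermite (1 - l) (- b)"
  define fl where "fl x = - (pR * hermite (- l) (- b - x))" for x
  define fr where "fr x = sqrt h * pL * hermite (- (l / h)) (y x)" for x
  define ql where "ql x = l * pR * hermite (1 - l) (- b - x)" for x
  define qr where "qr x = l * pL * hermite (1 - l / h) (y x)" for x
  define f where "f x = (if x < 0 then fl x else fr x)" for x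
  define p where "p x = (if x < 0 then ql x else qr x)" for x
  have gr: "l > 0" "\<And>t. t \<ge> - b \<Longrightarrow> hermite (1 - l) t > 0" "\<And>t. t \<ge> b / sqrt h \<Longrightarrow> hermite (1 - l / h) t > 0"
    "hermite (- l) (- b) * pR + sqrt h * hermite (- (l / h)) (b / sqrt h) * pL = 0"
    using g by (auto simp: ground_def matching_def pR_def pL_def)
  have sh: "sqrt h > 0" "sqrt h * sqrt h = h" using h by auto
  have pos: "pR > 0" "pL > 0" using gr by (auto simp: pR_def pL_def)
  have yd: "(y has_real_derivative sqrt h) (at x)" for x
  proof -
    have "((\<lambda>x. b + h * x) has_real_derivative h) (at x)"
      by (auto intro!: derivative_eq_intros)
    then have "(y has_real_derivative h / sqrt h) (at x)"
      unfolding y_def [abs_def] by (rule DERIV_cdivide)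
    then show ?thesis using h by (simp add: real_div_sqrt)
  qed
  have zd: "((\<lambda>x. - b - x) has_real_derivative -1) (at x)" for x
    by (auto intro!: derivative_eq_intros)
  have fl': "(fl has_real_derivative ql x) (at x)" for x
    unfolding fl_def by (rule DERIV_cong[OF DERIV_minus[OF DERIV_cmult[OF DERIV_chain2[OF hermite_deriv zd]]]])
      (simp add: ql_def)
  have fr': "(fr has_real_derivative qr x) (at x)" for x
  proof -
    have "sqrt h * pL * (- (- (l / h)) * hermite (- (l / h) + 1) (y x) * sqrt h)
        = (sqrt h * sqrt h) * (l / h * pL * hermite (- (l / h) + 1) (y x))"
      by (simp only: minus_minus mult_ac)
    also have "\<dots> = qr x" unfolding sh(2) using h by (simp add: qr_def)
    finally show ?thesis
      unfolding fr_def by (rule DERIV_cong[OF DERIV_cmult[OF DERIV_chain2[OF hermite_deriv yd]]])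
  qed
  have ql': "(ql has_real_derivative (b + x) * ql x - l * fl x) (at x)" for x
    unfolding ql_def by (rule DERIV_cong[OF DERIV_cmult[OF DERIV_chain2[OF hermite_deriv' zd]]])
      (simp add: ql_def fl_def algebra_simps)
  have qr': "(qr has_real_derivative (b + h * x) * qr x - l * fr x) (at x)" for x
  proof -
    have "sqrt h * y x = b + h * x" using sh by (simp add: y_def)
    then have "(b + h * x) * qr x - l * fr x = l * pL * ((y x * hermite (1 - l / h) (y x) - hermite (1 - l / h - 1) (y x)) * sqrt h)"
      by (simp add: qr_def fr_def algebra_simps flip: \<open>sqrt h * y x = b + h * x\<close>)
    then show ?thesis
      unfolding qr_def by (intro DERIV_cong[OF DERIV_cmult[OF DERIV_chain2[OF hermite_deriv' yd]]])
        (simp add: qr_def)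
  qed
  have f0: "fl 0 = fr 0"
    using gr(4) by (simp add: fl_def fr_def y_def algebra_simps)
  have q0: "ql 0 = qr 0"
    by (simp add: ql_def qr_def y_def pR_def pL_def)
  have 1: "(f has_real_derivative p x) (at x)" for x
    unfolding f_def [abs_def] p_def by (rule DERIV_glue) (use fl' fr' f0 q0 in auto)
  have 2: "(p has_real_derivative - drift b h x * p x - l * f x) (at x)" for x
  proof -
    have "((\<lambda>x. if x < 0 then ql x else qr x) has_real_derivative
        (if x < 0 then (b + x) * ql x - l * fl x else (b + h * x) * qr x - l * fr x)) (at x)"
      by (rule DERIV_glue) (use ql' qr' f0 q0 in auto)
    then show ?thesis
      unfolding p_def [abs_def] by (rule DERIV_cong) (simp add: f_def p_def drift_def algebra_simps)
  qed
  have 3: "p x > 0" for x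
  proof (cases "x < 0")
    case True
    then show ?thesis using gr(1) pos gr(2)[of "- b - x"] by (simp add: p_def ql_def)
  next
    case False
    then have "y x \<ge> b / sqrt h"
      using h unfolding y_def by (intro divide_right_mono) auto
    then show ?thesis using False gr(1) pos gr(3)[of "y x"] by (simp add: p_def qr_def)
  qed
  obtain C1 where C1: "C1 \<ge> 0" "\<And>z. z \<ge> 0 \<Longrightarrow> exp (b * z / 2 - z\<^sup>2 / 4) * \<bar>hermite (- l) (- b + z)\<bar> \<le> C1 * exp (- (1 / 16) * z\<^sup>2)"
    using hermite_side_decay[of 1 "- b" "- l"] by auto
  obtain C2 where C2: "C2 \<ge> 0" "\<And>z. z \<ge> 0 \<Longrightarrow> exp (b * z / 2 - z\<^sup>2 / 4) * \<bar>hermite (1 - l) (- b + z)\<bar> \<le> C2 * exp (- (1 / 16) * z\<^sup>2)"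
    using hermite_side_decay[of 1 "- b" "1 - l"] by auto
  obtain C3 where C3: "C3 \<ge> 0" "\<And>z. z \<ge> 0 \<Longrightarrow> exp (- b * z / 2 - h * z\<^sup>2 / 4) * \<bar>hermite (- (l / h)) (y z)\<bar> \<le> C3 * exp (- (h / 16) * z\<^sup>2)"
    using hermite_side_decay[OF h, of b "- (l / h)"] by (auto simp: y_def)
  obtain C4 where C4: "C4 \<ge> 0" "\<And>z. z \<ge> 0 \<Longrightarrow> exp (- b * z / 2 - h * z\<^sup>2 / 4) * \<bar>hermite (1 - l / h) (y z)\<bar> \<le> C4 * exp (- (h / 16) * z\<^sup>2)"
    using hermite_side_decay[OF h, of b "1 - l / h"] by (auto simp: y_def)
  define d where "d = min (1 / 16) (h / 16)"
  define D1 where "D1 = pR * C1" define D2 where "D2 = l * pR * C2"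
  define D3 where "D3 = sqrt h * pL * C3" define D4 where "D4 = l * pL * C4"
  define C where "C = D1 + D2 + D3 + D4"
  have Ds: "D1 \<ge> 0" "D2 \<ge> 0" "D3 \<ge> 0" "D4 \<ge> 0"
    using C1 C2 C3 C4 gr(1) pos sh by (auto simp: D1_def D2_def D3_def D4_def)
  have d: "d > 0" "d \<le> 1 / 16" "d \<le> h / 16" using h by (auto simp: d_def)
  have e: "D * exp (- k * x\<^sup>2) \<le> C * exp (- d * x\<^sup>2)" if "0 \<le> D" "D \<le> C" "d \<le> k" for D k x
    using that by (intro mult_mono) (auto intro: mult_right_mono)
  have wl: "weight b h x = exp (b * (- x) / 2 - (- x)\<^sup>2 / 4)" if "x < 0" for x
    using that by (simp add: weight_def)
  have wr: "weight b h x = exp (- b * x / 2 - h * x\<^sup>2 / 4)" if "\<not> x < 0" for x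
    using that by (simp add: weight_def)
  have 4: "weight b h x * \<bar>f x\<bar> \<le> C * exp (- d * x\<^sup>2)" for x
  proof (cases "x < 0")
    case True
    have "weight b h x * \<bar>f x\<bar> = pR * (exp (b * (- x) / 2 - (- x)\<^sup>2 / 4) * \<bar>hermite (- l) (- b + (- x))\<bar>)"
      using True pos by (simp add: wl f_def fl_def abs_mult)
    also have "\<dots> \<le> pR * (C1 * exp (- (1 / 16) * (- x)\<^sup>2))"
      using True pos by (intro mult_left_mono C1) auto
    also have "\<dots> = D1 * exp (- (1 / 16) * x\<^sup>2)" by (simp add: D1_def)
    also have "\<dots> \<le> C * exp (- d * x\<^sup>2)" by (rule e) (use Ds d in \<open>auto simp: C_def\<close>)
    finally show ?thesis .
  next
    case False
    have "weight b h x * \<bar>f x\<bar> = sqrt h * pL * (exp (- b * x / 2 - h * x\<^sup>2 / 4) * \<bar>hermite (- (l / h)) (y x)\<bar>)"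
      using False pos h unfolding wr[OF False] by (simp add: f_def fr_def abs_mult)
    also have "\<dots> \<le> sqrt h * pL * (C3 * exp (- (h / 16) * x\<^sup>2))"
      using False pos h by (intro mult_left_mono C3) auto
    also have "\<dots> = D3 * exp (- (h / 16) * x\<^sup>2)" by (simp add: D3_def)
    also have "\<dots> \<le> C * exp (- d * x\<^sup>2)" by (rule e) (use Ds d in \<open>auto simp: C_def\<close>)
    finally show ?thesis .
  qed
  have 5: "weight b h x * \<bar>p x\<bar> \<le> C * exp (- d * x\<^sup>2)" for x
  proof (cases "x < 0")
    case True
    have "weight b h x * \<bar>p x\<bar> = l * pR * (exp (b * (- x) / 2 - (- x)\<^sup>2 / 4) * \<bar>hermite (1 - l) (- b + (- x))\<bar>)"
      using True pos gr(1) by (simp add: wl p_def ql_def abs_mult)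
    also have "\<dots> \<le> l * pR * (C2 * exp (- (1 / 16) * (- x)\<^sup>2))"
      using True pos gr(1) by (intro mult_left_mono C2) auto
    also have "\<dots> = D2 * exp (- (1 / 16) * x\<^sup>2)" by (simp add: D2_def)
    also have "\<dots> \<le> C * exp (- d * x\<^sup>2)" by (rule e) (use Ds d in \<open>auto simp: C_def\<close>)
    finally show ?thesis .
  next
    case False
    have "weight b h x * \<bar>p x\<bar> = l * pL * (exp (- b * x / 2 - h * x\<^sup>2 / 4) * \<bar>hermite (1 - l / h) (y x)\<bar>)"
      using False pos gr(1) unfolding wr[OF False] by (simp add: p_def qr_def abs_mult)
    also have "\<dots> \<le> l * pL * (C4 * exp (- (h / 16) * x\<^sup>2))"
      using False pos gr(1) by (intro mult_left_mono C4) auto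
    also have "\<dots> = D4 * exp (- (h / 16) * x\<^sup>2)" by (simp add: D4_def)
    also have "\<dots> \<le> C * exp (- d * x\<^sup>2)" by (rule e) (use Ds d in \<open>auto simp: C_def\<close>)
    finally show ?thesis .
  qed
  have "C \<ge> 0" using Ds by (simp add: C_def)
  with 1 2 3 4 5 d(1) that show ?thesis by blast
qed

section \<open>Ground levels are eigenvalues, and no positive eigenvalue lies below them\<close>

lemma integrable_exp_abs: "integrable lborel (\<lambda>x::real. exp (- \<bar>x\<bar>))"
proof -
  have i: "integrable lborel (\<lambda>u::real. indicator {0<..} u * exp (- u))"
    using integrable_exp_minus[of 1] by simp
  have "integrable lborel (\<lambda>u::real. indicator {0<..} (0 + (-1) * u) * exp (- (0 + (-1) * u)))"
    by (rule lborel_integrable_real_affine[OF i]) simp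
  from Bochner_Integration.integrable_add[OF i this]
  have "integrable lborel (\<lambda>u::real. indicator {0<..} u * exp (- u) + indicator {0<..} (- u) * exp u)" by simp
  then show ?thesis
    by (rule Bochner_Integration.integrable_bound)
       (use AE_lborel_singleton[of "0::real"] in \<open>auto elim!: eventually_mono simp: indicator_def abs_if\<close>)
qed

lemma integrable_gaussian_bound:
  fixes g :: "real \<Rightarrow> real"
  assumes "g \<in> borel_measurable borel" "d > 0" "\<And>x. \<bar>g x\<bar> \<le> C * exp (- d * x\<^sup>2)"
  shows "integrable lborel g"
proof (rule Bochner_Integration.integrable_bound)
  show "integrable lborel (\<lambda>x. (\<bar>C\<bar> * exp (1 / (4 * d))) * exp (- \<bar>x\<bar>))"
    by (intro integrable_mult_right integrable_exp_abs)
  have "norm (g x) \<le> norm ((\<bar>C\<bar> * exp (1 / (4 * d))) * exp (- \<bar>x\<bar>))" for x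
  proof -
    \<comment> \<open>The square yields d x^2 >= |x| - 1/(4d), which reduces the Gaussian to
      exp(-|x|).\<close>
    have "0 \<le> (2 * d * \<bar>x\<bar> - 1)\<^sup>2 / (4 * d)" using assms by simp
    also have "\<dots> = d * x\<^sup>2 - \<bar>x\<bar> + 1 / (4 * d)"
      using assms by (simp add: power2_diff power_mult_distrib field_simps) (simp add: power2_eq_square)
    finally have "- d * x\<^sup>2 \<le> 1 / (4 * d) + - \<bar>x\<bar>" by simp
    then have "exp (- d * x\<^sup>2) \<le> exp (1 / (4 * d)) * exp (- \<bar>x\<bar>)" unfolding exp_add [symmetric] by simp
    moreover have "\<bar>g x\<bar> \<le> \<bar>C\<bar> * exp (- d * x\<^sup>2)"
      using assms(3)[of x] by (rule order_trans) (simp add: mult_right_mono)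
    moreover have "\<bar>C\<bar> * exp (- d * x\<^sup>2) \<le> \<bar>C\<bar> * (exp (1 / (4 * d)) * exp (- \<bar>x\<bar>))"
      using calculation by (intro mult_left_mono) auto
    ultimately show ?thesis by (simp add: abs_mult)
  qed
  then show "AE x in lborel. norm (g x) \<le> norm ((\<bar>C\<bar> * exp (1 / (4 * d))) * exp (- \<bar>x\<bar>))" by simp
qed (use assms in simp)

lemma ground_eigenfunction:
  assumes h: "h > 0" and g: "ground 1 h b l"
  shows "\<exists>\<psi>. eigenfunction b h l \<psi>"
proof -
  obtain f p C d where fp: "\<And>x. (f has_real_derivative p x) (at x)"
    "\<And>x. (p has_real_derivative - drift b h x * p x - l * f x) (at x)"
    "\<And>x. p x > 0" "d > 0" "C \<ge> 0"
    "\<And>x. weight b h x * \<bar>f x\<bar> \<le> C * exp (- d * x\<^sup>2)"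
    using ground_pair[OF h g] by metis
  define e where "e = weight b h"
  define a where "a = drift b h"
  define \<psi> where "\<psi> x = e x * f x" for x
  define D where "D x = e x * (p x + a x / 2 * f x)" for x
  have e': "(e has_real_derivative a x / 2 * e x) (at x)" for x
    unfolding e_def a_def by (rule weight_deriv)
  have \<psi>': "(\<psi> has_real_derivative D x) (at x)" for x
    unfolding \<psi>_def [abs_def] by (rule DERIV_cong[OF DERIV_mult[OF e' fp(1)]]) (simp add: D_def algebra_simps)
  then have dD: "deriv \<psi> = D" by (auto intro: DERIV_imp_deriv)
  have D': "(D has_real_derivative (potential b h x - (l + 1 / 2)) * \<psi> x) (at x)" if "x \<noteq> 0" for x
  proof -
    define k where "k = (if x < 0 then -1 else - h)"
    have a': "(a has_real_derivative k) (at x)"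
      unfolding a_def k_def by (rule drift_deriv[OF that])
    have "(D has_real_derivative (a x / 2 * e x) * (p x + a x / 2 * f x)
        + ((- a x * p x - l * f x) + (k / 2 * f x + p x * (a x / 2))) * e x) (at x)"
      unfolding D_def [abs_def]
      by (intro DERIV_mult e' DERIV_add fp(1) DERIV_cdivide a') (use fp(2) in \<open>simp add: a_def\<close>)
    then show ?thesis
      by (rule DERIV_cong)
         (simp add: potential_drift[OF that] \<psi>_def power2_eq_square field_simps flip: a_def k_def)
  qed
  \<comment> \<open>Only the slope of the drift jumps at 0; the drift itself is continuous, and
    hence so is psi'.\<close>
  have "isCont D 0"
    unfolding D_def [abs_def] a_def
    by (intro continuous_intros DERIV_isCont[OF fp(1)] DERIV_isCont[OF fp(2)] DERIV_isCont[OF e'] drift_isCont) simp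
  moreover have "\<psi> differentiable (at x)" for x
    using \<psi>' by (auto simp: real_differentiable_def)
  moreover have "D differentiable (at x) \<and> - deriv D x + potential b h x * \<psi> x = (l + 1 / 2) * \<psi> x" if "x \<noteq> 0" for x
    using D'[OF that] DERIV_imp_deriv[OF D'[OF that]] by (auto simp: real_differentiable_def algebra_simps)
  moreover have "integrable lborel (\<lambda>x. (\<psi> x)\<^sup>2)"
  proof (rule integrable_gaussian_bound)
    have "continuous_on UNIV \<psi>"
      using \<psi>' by (auto intro!: continuous_at_imp_continuous_on DERIV_isCont)
    then have "\<psi> \<in> borel_measurable borel" by (rule borel_measurable_continuous_onI)
    then show "(\<lambda>x. (\<psi> x)\<^sup>2) \<in> borel_measurable borel" by simp
    show "2 * d > 0" using fp by simp
    show "\<bar>(\<psi> x)\<^sup>2\<bar> \<le> C\<^sup>2 * exp (- (2 * d) * x\<^sup>2)" for x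
    proof -
      have "\<bar>\<psi> x\<bar> \<le> C * exp (- d * x\<^sup>2)"
        using fp(6)[of x] weight_pos[of b h x] by (simp add: \<psi>_def e_def abs_mult)
      then have "\<bar>\<psi> x\<bar>\<^sup>2 \<le> (C * exp (- d * x\<^sup>2))\<^sup>2" by (rule power_mono) simp
      also have "\<dots> = C\<^sup>2 * exp (- (2 * d) * x\<^sup>2)"
        by (simp add: power2_eq_square mult_exp_exp)
      finally show ?thesis by simp
    qed
  qed
  moreover have "\<exists>x. \<psi> x \<noteq> 0"
  proof (rule ccontr)
    assume "\<nexists>x. \<psi> x \<noteq> 0"
    then have "e x * f x = 0" for x by (simp add: \<psi>_def)
    then have "f x = 0" for x using weight_pos[of b h x] unfolding e_def by (metis less_irrefl mult_eq_0_iff)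
    then have "f = (\<lambda>x. 0)" by blast
    then have "(f has_real_derivative 0) (at 0)" by simp
    then show False using fp(3)[of 0] DERIV_unique[OF fp(1)] by fastforce
  qed
  ultimately have "eigenfunction b h l \<psi>" unfolding eigenfunction_def dD by blast
  then show ?thesis by blast
qed

text \<open>For q >= 0 the product psi psi' is nondecreasing. Were it positive somewhere, psi^2
  would stay above a positive constant and not be integrable; so it is nonpositive and |psi|
  decreases. The mean value theorem with q <= B x^2 then bounds psi' by a cubic.\<close>

lemma L2_bounded:
  fixes \<psi> D q :: "real \<Rightarrow> real"
  assumes \<psi>: "\<And>x. x \<ge> X \<Longrightarrow> (\<psi> has_real_derivative D x) (at x)"
    and D: "\<And>x. x \<ge> X \<Longrightarrow> (D has_real_derivative q x * \<psi> x) (at x)"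
    and q: "\<And>x. x \<ge> X \<Longrightarrow> 0 \<le> q x \<and> q x \<le> B * x\<^sup>2"
    and int: "integrable lborel (\<lambda>x. (\<psi> x)\<^sup>2)"
    and X: "X \<ge> 1"
  shows "\<exists>K\<ge>0. \<forall>x\<ge>X. \<bar>\<psi> x\<bar> \<le> K \<and> \<bar>D x\<bar> \<le> K * x ^ 3"
proof -
  define S where "S x = \<psi> x * D x" for x
  have S': "(S has_real_derivative (D x)\<^sup>2 + q x * (\<psi> x)\<^sup>2) (at x)" if "x \<ge> X" for x
    unfolding S_def by (rule DERIV_cong[OF DERIV_mult[OF \<psi>[OF that] D[OF that]]])
      (simp add: power2_eq_square algebra_simps)
  have S_mono: "S x \<le> S y" if "X \<le> x" "x \<le> y" for x y
  proof (rule DERIV_nonneg_imp_nondecreasing[OF that(2)])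
    fix z assume "x \<le> z" "z \<le> y"
    then have "z \<ge> X" using that by simp
    moreover have "(D z)\<^sup>2 + q z * (\<psi> z)\<^sup>2 \<ge> 0" using q[OF \<open>z \<ge> X\<close>] by simp
    ultimately show "\<exists>d. (S has_real_derivative d) (at z) \<and> d \<ge> 0" using S' by blast
  qed
  have sq': "((\<lambda>x. (\<psi> x)\<^sup>2) has_real_derivative 2 * S x) (at x)" if "x \<ge> X" for x
    unfolding power2_eq_square by (rule DERIV_cong[OF DERIV_mult[OF \<psi>[OF that] \<psi>[OF that]]])
      (simp add: S_def)
  have S_nonpos: "S x \<le> 0" if x: "x \<ge> X" for x
  proof (rule ccontr)
    assume "\<not> S x \<le> 0"
    then have Sx: "S x > 0" by simp
    define c where "c = (\<psi> x)\<^sup>2"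
    have "c > 0" using Sx by (auto simp: c_def S_def)
    have ge: "(\<psi> y)\<^sup>2 \<ge> c" if "y \<ge> x" for y
      unfolding c_def
    proof (rule DERIV_nonneg_imp_nondecreasing[OF that])
      fix z assume "x \<le> z" "z \<le> y"
      then have "z \<ge> X" "2 * S z \<ge> 0" using x Sx S_mono[of x z] by auto
      then show "\<exists>d. ((\<lambda>x. (\<psi> x)\<^sup>2) has_real_derivative d) (at z) \<and> d \<ge> 0" using sq' by blast
    qed
    define I where "I = (\<integral>y. (\<psi> y)\<^sup>2 \<partial>lborel)"
    have "c * real n \<le> I" for n
    proof -
      have "(\<integral>y. c * indicator {x..x + real n} y \<partial>lborel) \<le> I"
        unfolding I_def
      proof (rule integral_mono[OF _ int])
        show "integrable lborel (\<lambda>y. c * indicator {x..x + real n} y)"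
          by (intro integrable_mult_right integrable_real_indicator) auto
        show "c * indicator {x..x + real n} y \<le> (\<psi> y)\<^sup>2" for y
          using ge[of y] by (simp add: indicator_def)
      qed
      then show ?thesis by simp
    qed
    note le = this
    obtain n :: nat where "real n > I / c" using reals_Archimedean2 by blast
    then have "I < c * real n" using \<open>c > 0\<close> by (simp add: pos_divide_less_eq mult.commute)
    then show False using le[of n] by simp
  qed
  have b1: "\<bar>\<psi> x\<bar> \<le> \<bar>\<psi> X\<bar>" if "x \<ge> X" for x
  proof -
    have "(\<psi> x)\<^sup>2 \<le> (\<psi> X)\<^sup>2"
    proof (rule DERIV_nonpos_imp_nonincreasing[OF that])
      fix z assume "X \<le> z" "z \<le> x"
      then show "\<exists>d. ((\<lambda>x. (\<psi> x)\<^sup>2) has_real_derivative d) (at z) \<and> d \<le> 0"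
        using sq'[of z] S_nonpos[of z] by (intro exI[of _ "2 * S z"]) auto
    qed
    then show ?thesis by (simp add: abs_le_square_iff)
  qed
  define K where "K = \<bar>D X\<bar> + \<bar>B\<bar> * \<bar>\<psi> X\<bar>"
  have b2: "\<bar>D x\<bar> \<le> K * x ^ 3" if "x \<ge> X" for x
  proof (cases "x = X")
    case True
    have "\<bar>D X\<bar> \<le> K * 1" by (simp add: K_def)
    also have "\<dots> \<le> K * X ^ 3" using X by (intro mult_left_mono one_le_power) (auto simp: K_def)
    finally show ?thesis using True by simp
  next
    case False
    then have "X < x" using that by simp
    from MVT2[OF this, of D "\<lambda>z. q z * \<psi> z"] D
    obtain z where z: "X < z" "z < x" "D x - D X = (x - X) * (q z * \<psi> z)" by blast
    have "\<bar>q z * \<psi> z\<bar> \<le> (\<bar>B\<bar> * x\<^sup>2) * \<bar>\<psi> X\<bar>"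
      unfolding abs_mult
    proof (intro mult_mono b1)
      have "\<bar>q z\<bar> \<le> B * z\<^sup>2" using q[of z] z by auto
      also have "\<dots> \<le> \<bar>B\<bar> * x\<^sup>2" using z X by (intro mult_mono power_mono) auto
      finally show "\<bar>q z\<bar> \<le> \<bar>B\<bar> * x\<^sup>2" .
    qed (use z in auto)
    then have "\<bar>x - X\<bar> * \<bar>q z * \<psi> z\<bar> \<le> x * ((\<bar>B\<bar> * x\<^sup>2) * \<bar>\<psi> X\<bar>)"
      using that X by (intro mult_mono) auto
    then have "\<bar>D x - D X\<bar> \<le> \<bar>B\<bar> * \<bar>\<psi> X\<bar> * x ^ 3"
      unfolding z(3) abs_mult by (simp add: power3_eq_cube power2_eq_square algebra_simps)
    moreover have "\<bar>D X\<bar> * 1 \<le> \<bar>D X\<bar> * x ^ 3"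
      using X that by (intro mult_left_mono one_le_power) auto
    ultimately show ?thesis unfolding K_def distrib_right by linarith
  qed
  show ?thesis
  proof (intro exI[of _ "K + \<bar>\<psi> X\<bar>"] conjI allI impI)
    show "0 \<le> K + \<bar>\<psi> X\<bar>" by (simp add: K_def)
    fix x assume x: "x \<ge> X"
    have "K \<ge> 0" by (simp add: K_def)
    then show "\<bar>\<psi> x\<bar> \<le> K + \<bar>\<psi> X\<bar>" using b1[OF x] by linarith
    have "K * x ^ 3 \<le> (K + \<bar>\<psi> X\<bar>) * x ^ 3" using x X by (intro mult_right_mono) auto
    then show "\<bar>D x\<bar> \<le> (K + \<bar>\<psi> X\<bar>) * x ^ 3" using b2[OF x] by linarith
  qed
qed

text \<open>The jump of the potential leaves second-order information only off 0; continuity joins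
  the two monotone pieces.\<close>

lemma mono_off_0:
  fixes k :: "real \<Rightarrow> real"
  assumes "\<And>x. x \<noteq> 0 \<Longrightarrow> a < x \<Longrightarrow> x < b \<Longrightarrow> \<exists>d. (k has_real_derivative d) (at x) \<and> d \<ge> 0"
    and cont: "continuous_on UNIV k" and ab: "a \<le> b"
  shows "k a \<le> k b"
proof -
  have *: "k x \<le> k y" if "a \<le> x" "x \<le> y" "y \<le> b" "y \<le> 0 \<or> 0 \<le> x" for x y
  proof (rule DERIV_nonneg_imp_increasing_open[OF that(2)])
    fix z assume "x < z" "z < y"
    then show "\<exists>d. (k has_real_derivative d) (at z) \<and> d \<ge> 0" using that by (intro assms(1)) auto
  qed (rule continuous_on_subset[OF cont], simp)
  show ?thesis
  proof (cases "a < 0 \<and> 0 < b")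
    case True
    then show ?thesis using *[of a 0] *[of 0 b] by linarith
  qed (use *[of a b] ab in auto)
qed

lemma ev_potential:
  assumes "h > 0"
  shows "\<forall>\<^sub>F x in at_top. 0 \<le> potential b h x - m \<and> potential b h x - m \<le> (h\<^sup>2 + 1) * x\<^sup>2"
    "\<forall>\<^sub>F x in at_top. 0 \<le> potential b h (- x) - m \<and> potential b h (- x) - m \<le> (h\<^sup>2 + 1) * x\<^sup>2"
proof -
  have 1: "\<forall>\<^sub>F x in at_top. (b + h * x)\<^sup>2 / 4 + (1 - h) / 2 - m \<ge> 0" using assms by real_asymp
  have 2: "\<forall>\<^sub>F x in at_top. (h\<^sup>2 + 1) * x\<^sup>2 - ((b + h * x)\<^sup>2 / 4 + (1 - h) / 2 - m) \<ge> 0"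
  proof -
    have "\<forall>\<^sub>F x in at_top. x\<^sup>2 - (b\<^sup>2 / 2 + (1 - h) / 2 - m) \<ge> 0" by real_asymp
    then show ?thesis
    proof eventually_elim
      case (elim x)
      have "(b + h * x)\<^sup>2 + (b - h * x)\<^sup>2 = 2 * b\<^sup>2 + 2 * (h\<^sup>2 * x\<^sup>2)"
        by (simp add: power2_eq_square algebra_simps)
      moreover have "(b - h * x)\<^sup>2 \<ge> 0" "h\<^sup>2 * x\<^sup>2 \<ge> 0" by auto
      ultimately have "(b + h * x)\<^sup>2 / 4 \<le> b\<^sup>2 / 2 + h\<^sup>2 * x\<^sup>2" by linarith
      then show ?case using elim by (simp add: algebra_simps)
    qed
  qed
  have 3: "\<forall>\<^sub>F x in at_top. (b - x)\<^sup>2 / 4 - m \<ge> 0" by real_asymp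
  have 4: "\<forall>\<^sub>F x in at_top. x\<^sup>2 - ((b - x)\<^sup>2 / 4 - m) \<ge> 0" by real_asymp
  show "\<forall>\<^sub>F x in at_top. 0 \<le> potential b h x - m \<and> potential b h x - m \<le> (h\<^sup>2 + 1) * x\<^sup>2"
    using 1 2 eventually_gt_at_top[of 0] by eventually_elim (simp add: potential_def)
  show "\<forall>\<^sub>F x in at_top. 0 \<le> potential b h (- x) - m \<and> potential b h (- x) - m \<le> (h\<^sup>2 + 1) * x\<^sup>2"
    using 3 4 eventually_gt_at_top[of 0]
  proof eventually_elim
    case (elim x)
    have "x\<^sup>2 \<le> (h\<^sup>2 + 1) * x\<^sup>2" by (simp add: algebra_simps)
    moreover have "potential b h (- x) = (b - x)\<^sup>2 / 4" using elim by (simp add: potential_def)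
    ultimately show ?case using elim(1,2) by linarith
  qed
qed

lemma eigenfunction_D:
  assumes "eigenfunction b h m \<psi>"
  shows "(\<psi> has_real_derivative deriv \<psi> x) (at x)"
    "x \<noteq> 0 \<Longrightarrow> (deriv \<psi> has_real_derivative (potential b h x - (m + 1 / 2)) * \<psi> x) (at x)"
    "isCont (deriv \<psi>) x"
proof -
  show 1: "(\<psi> has_real_derivative deriv \<psi> x) (at x)"
    using assms by (simp add: eigenfunction_def DERIV_deriv_iff_real_differentiable)
  show 2: "(deriv \<psi> has_real_derivative (potential b h x - (m + 1 / 2)) * \<psi> x) (at x)" if "x \<noteq> 0"
  proof -
    have "(deriv \<psi> has_real_derivative deriv (deriv \<psi>) x) (at x)"
      using assms that by (simp add: eigenfunction_def DERIV_deriv_iff_real_differentiable)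
    moreover have "- deriv (deriv \<psi>) x + potential b h x * \<psi> x = (m + 1 / 2) * \<psi> x"
      using assms that by (simp add: eigenfunction_def)
    then have "deriv (deriv \<psi>) x = (potential b h x - (m + 1 / 2)) * \<psi> x"
      by (simp add: algebra_simps)
    ultimately show ?thesis by simp
  qed
  show "isCont (deriv \<psi>) x"
    using assms DERIV_isCont[OF 2] by (cases "x = 0") (auto simp: eigenfunction_def)
qed

lemma eigenfunction_bounds:
  assumes h: "h > 0" and e: "eigenfunction b h m \<psi>"
  shows "\<exists>K\<ge>0. \<exists>X. \<forall>x. \<bar>x\<bar> \<ge> X \<longrightarrow> \<bar>\<psi> x\<bar> \<le> K \<and> \<bar>deriv \<psi> x\<bar> \<le> K * \<bar>x\<bar> ^ 3"
proof -
  have int: "integrable lborel (\<lambda>x. (\<psi> x)\<^sup>2)" using e by (simp add: eigenfunction_def)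
  obtain X0 where X0: "\<And>x. x \<ge> X0 \<Longrightarrow> 0 \<le> potential b h x - (m + 1 / 2) \<and> potential b h x - (m + 1 / 2) \<le> (h\<^sup>2 + 1) * x\<^sup>2"
    "\<And>x. x \<ge> X0 \<Longrightarrow> 0 \<le> potential b h (- x) - (m + 1 / 2) \<and> potential b h (- x) - (m + 1 / 2) \<le> (h\<^sup>2 + 1) * x\<^sup>2"
    using eventually_conj[OF ev_potential[OF h, of b "m + 1 / 2"]] unfolding eventually_at_top_linorder by blast
  define X where "X = max X0 1"
  have X: "X \<ge> 1" "X \<ge> X0" by (auto simp: X_def)
  have "\<exists>K\<ge>0. \<forall>x\<ge>X. \<bar>\<psi> x\<bar> \<le> K \<and> \<bar>deriv \<psi> x\<bar> \<le> K * x ^ 3"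
    by (rule L2_bounded[OF eigenfunction_D(1)[OF e] eigenfunction_D(2)[OF e] X0(1) int X(1)]) (use X in auto)
  then obtain K1 where K1: "K1 \<ge> 0" "\<And>x. x \<ge> X \<Longrightarrow> \<bar>\<psi> x\<bar> \<le> K1 \<and> \<bar>deriv \<psi> x\<bar> \<le> K1 * x ^ 3" by blast
  have "\<exists>K\<ge>0. \<forall>x\<ge>X. \<bar>\<psi> (- x)\<bar> \<le> K \<and> \<bar>- deriv \<psi> (- x)\<bar> \<le> K * x ^ 3"
  proof (rule L2_bounded[OF _ _ X0(2) _ X(1)])
    fix x assume x: "x \<ge> X"
    have n: "((\<lambda>x. - x) has_real_derivative -1) (at x)" by (auto intro!: derivative_eq_intros)
    show "((\<lambda>x. \<psi> (- x)) has_real_derivative - deriv \<psi> (- x)) (at x)"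
      by (rule DERIV_cong[OF DERIV_chain2[OF eigenfunction_D(1)[OF e] n]]) simp
    show "((\<lambda>x. - deriv \<psi> (- x)) has_real_derivative (potential b h (- x) - (m + 1 / 2)) * \<psi> (- x)) (at x)"
      by (rule DERIV_cong[OF DERIV_minus[OF DERIV_chain2[OF eigenfunction_D(2)[OF e] n]]]) (use x X in auto)
  next
    show "integrable lborel (\<lambda>x. (\<psi> (- x))\<^sup>2)"
      using lborel_integrable_real_affine[OF int, of "-1" 0] by simp
  qed (use X in auto)
  then obtain K2 where K2: "K2 \<ge> 0" "\<And>x. x \<ge> X \<Longrightarrow> \<bar>\<psi> (- x)\<bar> \<le> K2 \<and> \<bar>deriv \<psi> (- x)\<bar> \<le> K2 * x ^ 3" by auto
  have "\<bar>\<psi> x\<bar> \<le> K1 + K2 \<and> \<bar>deriv \<psi> x\<bar> \<le> (K1 + K2) * \<bar>x\<bar> ^ 3" if "\<bar>x\<bar> \<ge> X" for x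
  proof -
    have le: "K1 * \<bar>x\<bar> ^ 3 \<le> (K1 + K2) * \<bar>x\<bar> ^ 3" "K2 * \<bar>x\<bar> ^ 3 \<le> (K1 + K2) * \<bar>x\<bar> ^ 3"
      using K1(1) K2(1) by (auto intro!: mult_right_mono)
    show ?thesis
    proof (cases "x \<ge> 0")
      case True
      then show ?thesis using K1(2)[of x] K1(1) K2(1) le that by auto
    next
      case False
      then have ax: "\<bar>x\<bar> = - x" by simp
      have "\<bar>\<psi> x\<bar> \<le> K2 \<and> \<bar>deriv \<psi> x\<bar> \<le> K2 * \<bar>x\<bar> ^ 3"
        using K2(2)[of "- x"] that unfolding ax minus_minus by blast
      then show ?thesis using K1(1) K2(1) le by linarith
    qed
  qed
  then show ?thesis using K1(1) K2(1) by (intro exI[of _ "K1 + K2"]) auto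
qed

text \<open>If m < l, then w^2 is nondecreasing to the right of any point with Z > 0 and
  nonincreasing to the left of any point with Z < 0. Either contradicts the decay of w, so Z
  vanishes identically; its derivative, a sum of squares, then forces w = P = 0.\<close>

lemma ground_minimal:
  assumes h: "h > 0" and g: "ground 1 h b l" and ef: "eigenfunction b h m \<psi>" and m: "m > 0"
  shows "l \<le> m"
proof (rule ccontr)
  assume "\<not> l \<le> m"
  then have lm: "m < l" by simp
  obtain f p C d where fp: "\<And>x. (f has_real_derivative p x) (at x)"
    "\<And>x. (p has_real_derivative - drift b h x * p x - l * f x) (at x)"
    "\<And>x. p x > 0" "d > 0" "C \<ge> 0"
    "\<And>x. weight b h x * \<bar>f x\<bar> \<le> C * exp (- d * x\<^sup>2)"
    "\<And>x. weight b h x * \<bar>p x\<bar> \<le> C * exp (- d * x\<^sup>2)"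
    using ground_pair[OF h g] by metis
  define e where "e = weight b h"
  define a where "a = drift b h"
  define D where "D = deriv \<psi>"
  \<comment> \<open>Undoing the weight: F solves the unconjugated equation for the level
    \<open>m\<close>, and P is its derivative.\<close>
  define F where "F x = \<psi> x / e x" for x
  define P where "P x = (D x - a x / 2 * \<psi> x) / e x" for x
  have e_pos: "e x > 0" for x unfolding e_def by (rule weight_pos)
  have e': "(e has_real_derivative a x / 2 * e x) (at x)" for x
    unfolding e_def a_def by (rule weight_deriv)
  note \<psi>' = eigenfunction_D(1)[OF ef, folded D_def]
  have F': "(F has_real_derivative P x) (at x)" for x
    unfolding F_def using e_pos[of x]
    by (intro DERIV_cong[OF DERIV_divide[OF \<psi>' e']]) (auto simp: P_def field_simps)
  have P': "(P has_real_derivative - a x * P x - m * F x) (at x)" if x: "x \<noteq> 0" for x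
  proof -
    define k where "k = (if x < 0 then -1 else - h)"
    define q where "q = potential b h x - (m + 1 / 2)"
    have a': "(a has_real_derivative k) (at x)"
      unfolding a_def k_def by (rule drift_deriv[OF x])
    have D': "(D has_real_derivative q * \<psi> x) (at x)"
      unfolding D_def q_def by (rule eigenfunction_D(2)[OF ef x])
    have q: "q = (a x)\<^sup>2 / 4 + k / 2 - m"
      unfolding q_def potential_drift[OF x] k_def a_def by simp
    show ?thesis
      unfolding P_def using e_pos[of x]
      by (intro DERIV_cong[OF DERIV_divide[OF DERIV_diff[OF D' DERIV_mult[OF DERIV_cdivide[OF a'] \<psi>']] e']])
         (auto simp: F_def P_def q field_simps power2_eq_square)
  qed
  have contF: "isCont F x" for x by (rule DERIV_isCont[OF F'])
  have conte: "isCont e x" for x by (rule DERIV_isCont[OF e'])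
  have contP: "isCont P x" for x
    unfolding P_def a_def D_def using e_pos[of x]
    by (intro continuous_intros eigenfunction_D(3)[OF ef] drift_isCont conte DERIV_isCont[OF \<psi>']) auto
  define w where "w x = (e x)\<^sup>2 * (m * (F x * p x) - l * (P x * f x))" for x
  define Z where "Z x = - (P x / p x) * w x" for x
  have contw: "continuous_on UNIV w"
    unfolding w_def by (intro continuous_at_imp_continuous_on ballI continuous_intros conte contF contP
        DERIV_isCont[OF fp(1)] DERIV_isCont[OF fp(2)])
  have contZ: "continuous_on UNIV Z"
    unfolding Z_def using fp(3) contw
    by (intro continuous_intros continuous_at_imp_continuous_on[of _ P] continuous_at_imp_continuous_on[of _ p]
        ballI contP DERIV_isCont[OF fp(2)]) (auto simp: less_imp_neq [symmetric])
  have w': "(w has_real_derivative (m - l) * ((e x)\<^sup>2 * P x * p x)) (at x)" if x: "x \<noteq> 0" for x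
  proof -
    have e2: "((\<lambda>x. (e x)\<^sup>2) has_real_derivative a x * (e x)\<^sup>2) (at x)"
      unfolding power2_eq_square by (rule DERIV_cong[OF DERIV_mult[OF e' e']]) simp
    have p': "(p has_real_derivative - a x * p x - l * f x) (at x)" using fp(2) by (simp add: a_def)
    show ?thesis
      unfolding w_def
      by (rule DERIV_cong[OF DERIV_mult[OF e2 DERIV_diff[OF DERIV_cmult[OF DERIV_mult[OF F' p']]
            DERIV_cmult[OF DERIV_mult[OF P'[OF x] fp(1)]]]]]) (simp add: algebra_simps)
  qed
  have Z': "(Z has_real_derivative (w x)\<^sup>2 / ((e x)\<^sup>2 * (p x)\<^sup>2) + (l - m) * ((e x)\<^sup>2 * (P x)\<^sup>2)) (at x)"
    if x: "x \<noteq> 0" for x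
  proof -
    have p': "(p has_real_derivative - a x * p x - l * f x) (at x)" using fp(2) by (simp add: a_def)
    have pe: "p x > 0" "e x > 0" using fp(3) e_pos by auto
    have "((- a x * P x - m * F x) * p x - P x * (- a x * p x - l * f x)) / (p x * p x)
        = - (w x / ((e x)\<^sup>2 * (p x)\<^sup>2))"
      using pe by (simp add: w_def field_simps power2_eq_square)
    with DERIV_divide[OF P'[OF x] p'] pe
    have g: "((\<lambda>x. P x / p x) has_real_derivative - (w x / ((e x)\<^sup>2 * (p x)\<^sup>2))) (at x)"
      by simp
    have "- (- (w x / ((e x)\<^sup>2 * (p x)\<^sup>2))) * w x + (m - l) * ((e x)\<^sup>2 * P x * p x) * (- (P x / p x))
       = (w x)\<^sup>2 / ((e x)\<^sup>2 * (p x)\<^sup>2) + (l - m) * ((e x)\<^sup>2 * (P x)\<^sup>2)"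
      using pe by (simp add: power2_eq_square algebra_simps)
    with DERIV_mult[OF DERIV_minus[OF g] w'[OF x]] show ?thesis
      unfolding Z_def [abs_def] by simp
  qed
  have w2': "((\<lambda>x. (w x)\<^sup>2) has_real_derivative 2 * (l - m) * ((e x)\<^sup>2 * (p x)\<^sup>2) * Z x) (at x)"
    if x: "x \<noteq> 0" for x
    unfolding power2_eq_square using fp(3)[of x]
    by (intro DERIV_cong[OF DERIV_mult[OF w'[OF x] w'[OF x]]]) (simp add: Z_def power2_eq_square field_simps)
  have Z_mono: "Z x \<le> Z y" if "x \<le> y" for x y
  proof (rule mono_off_0[OF _ contZ that])
    fix x :: real assume "x \<noteq> 0"
    have "(w x)\<^sup>2 / ((e x)\<^sup>2 * (p x)\<^sup>2) + (l - m) * ((e x)\<^sup>2 * (P x)\<^sup>2) \<ge> 0" using lm by simp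
    then show "\<exists>d. (Z has_real_derivative d) (at x) \<and> d \<ge> 0" using Z'[OF \<open>x \<noteq> 0\<close>] by blast
  qed
  obtain K X where K: "K \<ge> 0" "\<And>x. \<bar>x\<bar> \<ge> X \<Longrightarrow> \<bar>\<psi> x\<bar> \<le> K \<and> \<bar>D x\<bar> \<le> K * \<bar>x\<bar> ^ 3"
    using eigenfunction_bounds[OF h ef] unfolding D_def by blast
  \<comment> \<open>One factor \<open>e\<close> of the square in \<open>w\<close> turns F and P back
    into expressions in psi and psi', which grow at most polynomially; the other makes p and f
    Gaussian.\<close>
  define B where "B y = (m * K + l * (K * y ^ 3 + (\<bar>b\<bar> + (1 + h) * y) * K)) * (C * exp (- d * y\<^sup>2))" for y
  have wB: "\<bar>w x\<bar> \<le> B \<bar>x\<bar>" if x: "\<bar>x\<bar> \<ge> X" for x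
  proof -
    define G where "G = C * exp (- d * x\<^sup>2)"
    have fG: "e x * \<bar>f x\<bar> \<le> G" "e x * \<bar>p x\<bar> \<le> G"
      using fp(6,7)[of x] by (auto simp: e_def G_def)
    have "w x = m * (\<psi> x * (e x * p x)) - l * ((D x - a x / 2 * \<psi> x) * (e x * f x))"
      using e_pos[of x] by (simp add: w_def F_def P_def power2_eq_square field_simps)
    then have "\<bar>w x\<bar> \<le> m * (\<bar>\<psi> x\<bar> * (e x * \<bar>p x\<bar>)) + l * (\<bar>D x - a x / 2 * \<psi> x\<bar> * (e x * \<bar>f x\<bar>))"
      using abs_triangle_ineq4[of "m * (\<psi> x * (e x * p x))" "l * ((D x - a x / 2 * \<psi> x) * (e x * f x))"]
        m lm e_pos[of x] by (simp add: abs_mult)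
    also have "\<dots> \<le> m * (K * G) + l * ((K * \<bar>x\<bar> ^ 3 + (\<bar>b\<bar> + (1 + h) * \<bar>x\<bar>) * K) * G)"
    proof (intro add_mono mult_left_mono[OF mult_mono[OF _ fG(2)]] mult_left_mono[OF mult_mono[OF _ fG(1)]])
      have "\<bar>a x\<bar> \<le> \<bar>b\<bar> + (1 + h) * \<bar>x\<bar>"
      proof -
        have "0 \<le> h * \<bar>x\<bar>" using h by simp
        moreover have "\<bar>a x\<bar> \<le> \<bar>b\<bar> + \<bar>if x < 0 then x else h * x\<bar>" by (simp add: a_def drift_def)
        moreover have "\<bar>h * x\<bar> = h * \<bar>x\<bar>" using h by (simp add: abs_mult)
        ultimately show ?thesis by (auto simp: distrib_right split: if_splits)
      qed
      then have "\<bar>a x / 2 * \<psi> x\<bar> \<le> (\<bar>b\<bar> + (1 + h) * \<bar>x\<bar>) * K"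
        unfolding abs_mult using K x by (intro mult_mono) auto
      then show "\<bar>D x - a x / 2 * \<psi> x\<bar> \<le> K * \<bar>x\<bar> ^ 3 + (\<bar>b\<bar> + (1 + h) * \<bar>x\<bar>) * K"
        using K(2)[OF x] by linarith
    qed (use m lm K x h e_pos[of x] in auto)
    also have "\<dots> = B \<bar>x\<bar>" by (simp add: B_def G_def algebra_simps)
    finally show ?thesis .
  qed
  have Blim: "(B \<longlongrightarrow> 0) at_top"
    unfolding B_def using fp(4) by real_asymp
  have small: "\<exists>Y. \<forall>x. \<bar>x\<bar> \<ge> Y \<longrightarrow> (w x)\<^sup>2 < c" if "c > 0" for c
  proof -
    have "((\<lambda>x. (B x)\<^sup>2) \<longlongrightarrow> 0\<^sup>2) at_top" by (intro tendsto_intros Blim)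
    then have "\<forall>\<^sub>F x in at_top. (B x)\<^sup>2 < c" using that by (intro order_tendstoD(2)) auto
    then obtain Y where Y: "\<And>x. x \<ge> Y \<Longrightarrow> (B x)\<^sup>2 < c" unfolding eventually_at_top_linorder by blast
    have "(w x)\<^sup>2 < c" if "\<bar>x\<bar> \<ge> max X Y" for x
    proof -
      have "\<bar>w x\<bar> \<le> B \<bar>x\<bar>" using wB that by simp
      then have "\<bar>w x\<bar>\<^sup>2 \<le> (B \<bar>x\<bar>)\<^sup>2" by (rule power_mono) simp
      also have "\<dots> < c" using Y that by simp
      finally show ?thesis by simp
    qed
    then show ?thesis by blast
  qed
  have Z0: "Z x = 0" for x
  proof (rule ccontr)
    assume "Z x \<noteq> 0"
    then have c: "(w x)\<^sup>2 > 0" by (auto simp: Z_def)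
    from small[OF c] obtain Y where Y: "\<And>x'. \<bar>x'\<bar> \<ge> Y \<Longrightarrow> (w x')\<^sup>2 < (w x)\<^sup>2" by blast
    consider "Z x > 0" | "Z x < 0" using \<open>Z x \<noteq> 0\<close> by linarith
    then show False
    proof cases
      case 1
      have "(w x)\<^sup>2 \<le> (w (max x Y))\<^sup>2"
      proof (rule mono_off_0[where k = "\<lambda>x. (w x)\<^sup>2"])
        fix z :: real assume z: "z \<noteq> 0" "x < z"
        have "Z z \<ge> 0" using Z_mono[of x z] z 1 by simp
        then have "2 * (l - m) * ((e z)\<^sup>2 * (p z)\<^sup>2) * Z z \<ge> 0" using lm by simp
        then show "\<exists>d. ((\<lambda>x. (w x)\<^sup>2) has_real_derivative d) (at z) \<and> d \<ge> 0" using w2'[OF z(1)] by blast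
      qed (auto intro!: continuous_intros contw)
      moreover have "Y \<le> \<bar>max x Y\<bar>" by linarith
      ultimately show False using Y[of "max x Y"] by linarith
    next
      case 2
      have "- (w (min x (- Y)))\<^sup>2 \<le> - (w x)\<^sup>2"
      proof (rule mono_off_0[where k = "\<lambda>x. - (w x)\<^sup>2"])
        fix z :: real assume z: "z \<noteq> 0" "z < x"
        have "Z z \<le> 0" using Z_mono[of z x] z 2 by simp
        then have "- (2 * (l - m) * ((e z)\<^sup>2 * (p z)\<^sup>2) * Z z) \<ge> 0"
          using lm by (simp add: mult_nonneg_nonpos)
        then show "\<exists>d. ((\<lambda>x. - (w x)\<^sup>2) has_real_derivative d) (at z) \<and> d \<ge> 0"
          using DERIV_minus[OF w2'[OF z(1)]] by blast
      qed (auto intro!: continuous_intros contw)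
      moreover have "Y \<le> \<bar>min x (- Y)\<bar>" by linarith
      ultimately show False using Y[of "min x (- Y)"] by linarith
    qed
  qed
  \<comment> \<open>P = 0 alone would allow the constant F of eigenvalue 0; w = 0 then reduces to m
    F p = 0, and m > 0 excludes it.\<close>
  have F0: "F x = 0" if x: "x \<noteq> 0" for x
  proof -
    have "Z = (\<lambda>x. 0)" using Z0 by blast
    then have "(w x)\<^sup>2 / ((e x)\<^sup>2 * (p x)\<^sup>2) + (l - m) * ((e x)\<^sup>2 * (P x)\<^sup>2) = 0"
      using DERIV_unique[OF Z'[OF x], of 0] by simp
    moreover have "(w x)\<^sup>2 / ((e x)\<^sup>2 * (p x)\<^sup>2) \<ge> 0" "(l - m) * ((e x)\<^sup>2 * (P x)\<^sup>2) \<ge> 0"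
      using lm by auto
    ultimately have "(w x)\<^sup>2 / ((e x)\<^sup>2 * (p x)\<^sup>2) = 0" "(l - m) * ((e x)\<^sup>2 * (P x)\<^sup>2) = 0"
      by linarith+
    then have "w x = 0" "P x = 0" using lm e_pos[of x] fp(3)[of x] by auto
    then show ?thesis using m e_pos[of x] fp(3)[of x] by (simp add: w_def)
  qed
  have "F 0 = 0"
  proof (rule tendsto_unique[of "at 0" F])
    show "(F \<longlongrightarrow> F 0) (at 0)" using contF[of 0] by (simp add: isCont_def)
    show "(F \<longlongrightarrow> 0) (at 0)"
      by (rule tendsto_eventually) (auto simp: eventually_at_filter F0)
  qed simp
  then have "F x = 0" for x using F0 by (cases "x = 0") auto
  then have "\<psi> x = 0" for x using e_pos[of x] unfolding F_def by (metis divide_eq_0_iff less_irrefl)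
  then show False using ef by (simp add: eigenfunction_def)
qed

text \<open>The \<open>LEAST\<close> over reals is determined because its minimum is exhibited. In
  particular the ground level is unique for given \<open>b\<close> and \<open>h\<close>.\<close>

lemma spectral_gap_eq:
  assumes "h > 0" "ground 1 h b l"
  shows "spectral_gap b h = l"
  unfolding spectral_gap_def
proof (rule Least_equality)
  show "0 < l \<and> (\<exists>\<psi>. eigenfunction b h l \<psi>)"
    using ground_eigenfunction[OF assms] assms(2) by (simp add: ground_def)
qed (use ground_minimal[OF assms] in blast)

text \<open>\<open>ground_exists\<close> covers slopes with d <= c; the case h > 1 is reduced to it
  by reflection.\<close>

lemma spectral_gap_ground:
  assumes "h > 0"
  shows "ground 1 h b (spectral_gap b h)" "spectral_gap b h \<in> {min 1 h..max 1 h}"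
proof -
  obtain l where l: "ground 1 h b l" "l \<in> {min 1 h..max 1 h}"
  proof (cases "h \<le> 1")
    case True
    then show ?thesis using ground_exists[of h 1 b] assms that by (auto simp: min_def max_def)
  next
    case False
    then show ?thesis using ground_exists[of 1 h "- b"] that ground_reflect[of h 1 b]
      by (auto simp: min_def max_def)
  qed
  with spectral_gap_eq[OF assms l(1)] show "ground 1 h b (spectral_gap b h)"
    "spectral_gap b h \<in> {min 1 h..max 1 h}" by auto
qed

section \<open>Continuity of the gap in the drift parameter\<close>

lemma spectral_gap_limit:
  assumes h: "h > 0" and "b \<longlonglongrightarrow> b0" "(\<lambda>n. spectral_gap (b n) h) \<longlonglongrightarrow> l"
  shows "spectral_gap b0 h = l"
proof -
  have "ground 1 h b0 l"
  proof (cases "h \<le> 1")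
    case True
    then show ?thesis
      using spectral_gap_ground[OF h] assms by (intro ground_limit[of h 1 "\<lambda>n. spectral_gap (b n) h" b]) auto
  next
    case False
    have "ground h 1 (- b0) l"
      using spectral_gap_ground[OF h] assms False
      by (intro ground_limit[of 1 h "\<lambda>n. spectral_gap (b n) h" "\<lambda>n. - b n"])
         (auto simp: ground_reflect intro: tendsto_minus)
    then show ?thesis by (simp add: ground_reflect)
  qed
  then show ?thesis by (rule spectral_gap_eq[OF h])
qed

text \<open>Compactness and uniqueness: the gap stays in [min 1 h, max 1 h], so a subsequence kept
  away from the gap at \<open>b0\<close> has a convergent further subsequence, whose limit is again
  the gap at \<open>b0\<close>.\<close>

lemma spectral_gap_isCont:
  assumes h: "h > 0"
  shows "isCont (\<lambda>b. spectral_gap b h) b0"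
proof (rule continuous_at_sequentiallyI)
  fix b :: "nat \<Rightarrow> real" assume b: "b \<longlonglongrightarrow> b0"
  show "(\<lambda>n. spectral_gap (b n) h) \<longlonglongrightarrow> spectral_gap b0 h"
  proof (rule ccontr)
    assume "\<not> ?thesis"
    then obtain e where e: "e > 0" "\<not> (\<forall>\<^sub>F n in sequentially. dist (spectral_gap (b n) h) (spectral_gap b0 h) < e)"
      unfolding tendsto_iff by blast
    define N where "N = {n. dist (spectral_gap (b n) h) (spectral_gap b0 h) \<ge> e}"
    have "\<exists>n\<ge>m. n \<in> N" for m
      using e(2) unfolding eventually_sequentially N_def mem_Collect_eq not_less [symmetric] by blast
    then have inf: "infinite N" unfolding infinite_nat_iff_unbounded_le by blast
    obtain \<sigma> :: "nat \<Rightarrow> nat" where \<sigma>: "strict_mono \<sigma>" "\<And>n. \<sigma> n \<in> N"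
      using infinite_enumerate[OF inf] by blast
    have sc: "seq_compact {min 1 h..max 1 h}" by (rule compact_imp_seq_compact) (rule compact_Icc)
    obtain l and \<tau> :: "nat \<Rightarrow> nat" where \<tau>: "strict_mono \<tau>" "((\<lambda>n. spectral_gap (b (\<sigma> n)) h) \<circ> \<tau>) \<longlonglongrightarrow> l"
      using seq_compactE[OF sc, of "\<lambda>n. spectral_gap (b (\<sigma> n)) h"] spectral_gap_ground(2)[OF h] by blast
    have "(b \<circ> (\<sigma> \<circ> \<tau>)) \<longlonglongrightarrow> b0"
      by (rule LIMSEQ_subseq_LIMSEQ[OF b strict_mono_o[OF \<sigma>(1) \<tau>(1)]])
    then have "spectral_gap b0 h = l"
      using \<tau>(2) by (intro spectral_gap_limit[OF h, of "b \<circ> (\<sigma> \<circ> \<tau>)"]) (auto simp: o_def)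
    then have "\<forall>\<^sub>F n in sequentially. dist (spectral_gap (b (\<sigma> (\<tau> n))) h) (spectral_gap b0 h) < e"
      using \<tau>(2) e(1) unfolding tendsto_iff by (simp add: o_def)
    then obtain n where "dist (spectral_gap (b (\<sigma> (\<tau> n))) h) (spectral_gap b0 h) < e"
      unfolding eventually_sequentially by blast
    then show False using \<sigma>(2)[of "\<tau> n"] unfolding N_def by simp
  qed
qed

section \<open>Dependence of the gap on the drift parameter\<close>

text \<open>Up to a constant factor this is f / f' on one side of the origin, the quantity to be
  matched at 0.\<close>

definition rho :: "real \<Rightarrow> real \<Rightarrow> real" where
  "rho s y = hermite (s - 1) y / hermite s y"

lemma rho_deriv:
  assumes "hermite s y \<noteq> 0"
  shows "(rho s has_real_derivative 1 - s + (rho s y)\<^sup>2 - y * rho s y) (at y)"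
  unfolding rho_def [abs_def] using assms
  by (intro DERIV_cong[OF DERIV_divide[OF hermite_pred_deriv hermite_deriv']])
     (auto simp: field_simps power2_eq_square)

lemma rho_deriv_pos:
  assumes pos: "\<And>t. t \<ge> y \<Longrightarrow> hermite s t > 0" and "s < 1" "rho s y \<ge> 0"
  shows "1 - s + (rho s y)\<^sup>2 - y * rho s y > 0"
proof -
  have J: "hermite s y > 0" using pos by simp
  then have "hermite (s - 1) y \<ge> 0" using assms(3) by (simp add: rho_def zero_le_divide_iff)
  from hermite_riccati_pos[OF pos assms(2) this] J
  have "0 < ((1 - s) * (hermite s y)\<^sup>2 + (hermite (s - 1) y)\<^sup>2 - y * (hermite s y * hermite (s - 1) y)) / (hermite s y)\<^sup>2" by simp
  also have "\<dots> = 1 - s + (rho s y)\<^sup>2 - y * rho s y"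
    using J by (simp add: rho_def field_simps power2_eq_square)
  finally show ?thesis .
qed

text \<open>An exact increment in the index s, with a quotient that is positive when the Hermite
  functions are and continuous in s' and y by \<open>tendsto_winteg\<close>.\<close>

lemma rho_diff:
  assumes "hermite s y \<noteq> 0" "hermite s' y \<noteq> 0"
  shows "rho s' y - rho s y = (s' - s) * (winteg s s' y / (hermite s y * hermite s' y))"
  using hermite_wronskian[of s y s'] assms by (simp add: rho_def field_simps)

text \<open>Implicit differentiation of the matching equation, with finite differences in the index
  and the Riccati equation in the argument.\<close>

lemma spectral_gap_deriv:
  assumes h: "h > 0"
  shows "\<exists>D>0. ((\<lambda>b. spectral_gap b h) has_real_derivative (1 - h) * D) (at b0)"
proof -
  define r where "r b = spectral_gap b h" for b
  define x where "x b = 1 - r b" for b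
  define z where "z b = 1 - r b / h" for b
  define k where "k = sqrt h"
  have k: "k > 0" "k * k = h" using h by (auto simp: k_def)
  have r_pos: "r b > 0" and L: "\<And>t. t \<ge> - b \<Longrightarrow> hermite (x b) t > 0"
    and R: "\<And>t. t \<ge> b / k \<Longrightarrow> hermite (z b) t > 0"
    and M: "hermite (x b - 1) (- b) * hermite (z b) (b / k) + k * hermite (z b - 1) (b / k) * hermite (x b) (- b) = 0" for b
    using spectral_gap_ground(1)[OF h, of b]
    by (auto simp: ground_def matching_def r_def x_def z_def k_def)
  have match: "rho (x b) (- b) + k * rho (z b) (b / k) = 0" for b
    using M[of b] L[of b "- b"] R[of b "b / k"] by (simp add: rho_def field_simps)
  have r_cont: "(r \<longlongrightarrow> r b0) (at b0)"
    using spectral_gap_isCont[OF h] unfolding r_def isCont_def .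
  have x_cont: "(x \<longlongrightarrow> x b0) (at b0)" and z_cont: "(z \<longlongrightarrow> z b0) (at b0)"
    unfolding x_def z_def using h by (auto intro!: tendsto_intros r_cont)
  \<comment> \<open>\<open>Q\<close> freezes the indices at \<open>b0\<close> and varies only the
    arguments, so the Riccati equation differentiates it. \<open>N\<close> collects the difference
    quotients in the index.\<close>
  define Q where "Q b = rho (x b0) (- b) + k * rho (z b0) (b / k)" for b
  define N where "N b = winteg (x b0) (x b) (- b) / (hermite (x b0) (- b) * hermite (x b) (- b))
      + winteg (z b0) (z b) (b / k) / (hermite (z b0) (b / k) * hermite (z b) (b / k)) / k" for b
  have nz: "hermite (x b0) (- b0) > 0" "hermite (z b0) (b0 / k) > 0" using L R by auto
  have N_lim: "(N \<longlongrightarrow> N b0) (at b0)"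
    unfolding N_def using nz k
    by (intro tendsto_intros tendsto_winteg x_cont z_cont) auto
  have N_pos: "N b0 > 0"
    unfolding N_def using nz k(1) by (intro add_pos_pos divide_pos_pos winteg_pos mult_pos_pos L R) auto
  have key: "\<forall>\<^sub>F b in at b0. (r b - r b0) * N b = Q b"
  proof -
    have "((\<lambda>b. hermite (x b0) (- b)) \<longlongrightarrow> hermite (x b0) (- b0)) (at b0)"
      "((\<lambda>b. hermite (z b0) (b / k)) \<longlongrightarrow> hermite (z b0) (b0 / k)) (at b0)"
      using k by (auto intro!: tendsto_intros)
    then have "\<forall>\<^sub>F b in at b0. hermite (x b0) (- b) > 0" "\<forall>\<^sub>F b in at b0. hermite (z b0) (b / k) > 0"
      using nz by (auto dest: order_tendstoD)
    then show ?thesis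
    proof eventually_elim
      case (elim b)
      define U where "U = winteg (x b0) (x b) (- b) / (hermite (x b0) (- b) * hermite (x b) (- b))"
      define V where "V = winteg (z b0) (z b) (b / k) / (hermite (z b0) (b / k) * hermite (z b) (b / k))"
      have "hermite (x b) (- b) > 0" "hermite (z b) (b / k) > 0" using L R by auto
      then have e1: "rho (x b) (- b) - rho (x b0) (- b) = (x b - x b0) * U"
        and e2: "rho (z b) (b / k) - rho (z b0) (b / k) = (z b - z b0) * V"
        unfolding U_def V_def using elim
        by (simp_all only: rho_diff less_imp_neq [symmetric] not_False_eq_True)
      have xe: "x b - x b0 = - (r b - r b0)" by (simp add: x_def)
      have ze: "k * (z b - z b0) = - (r b - r b0) / k"
        unfolding z_def k(2) [symmetric] using k(1) by (simp add: field_simps)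
      have "(rho (x b) (- b) - rho (x b0) (- b)) + k * (rho (z b) (b / k) - rho (z b0) (b / k))
          = - (r b - r b0) * U + - (r b - r b0) / k * V"
        unfolding e1 e2 xe mult.assoc [symmetric] ze by simp
      also have "\<dots> = - (r b - r b0) * N b"
        unfolding N_def U_def [symmetric] V_def [symmetric] by (simp add: algebra_simps diff_divide_distrib)
      finally have "(rho (x b) (- b) - rho (x b0) (- b)) + k * (rho (z b) (b / k) - rho (z b0) (b / k)) = - (r b - r b0) * N b" .
      then show ?case using match[of b] by (simp add: Q_def algebra_simps)
    qed
  qed
  define RL where "RL = 1 - x b0 + (rho (x b0) (- b0))\<^sup>2 - (- b0) * rho (x b0) (- b0)"
  define RR where "RR = 1 - z b0 + (rho (z b0) (b0 / k))\<^sup>2 - b0 / k * rho (z b0) (b0 / k)"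
  have "(Q has_real_derivative RL * (- 1) + k * (RR * (1 / k))) (at b0)"
    unfolding Q_def RL_def RR_def using nz k(1)
    by (intro DERIV_add DERIV_cmult DERIV_chain2[OF rho_deriv]) (auto intro!: derivative_eq_intros)
  then have Q': "(Q has_real_derivative RR - RL) (at b0)" using k by simp
  \<comment> \<open>Matching gives the left \<open>rho\<close> as -k times the right one; with k^2 =
    h each term on the left becomes h times its counterpart on the right.\<close>
  have RL_RR: "RL = h * RR"
  proof -
    have *: "rho (x b0) (- b0) = - (k * rho (z b0) (b0 / k))" using match[of b0] by simp
    define q where "q = rho (z b0) (b0 / k)"
    have x0: "1 - x b0 = h * (1 - z b0)" using h by (simp add: x_def z_def)
    have hk: "h * (b0 / k) = b0 * k" unfolding k(2) [symmetric] using k(1) by simp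
    have "RL = h * (1 - z b0) + (k * k) * q\<^sup>2 - b0 * k * q"
      unfolding RL_def * x0 q_def [symmetric] by (simp add: power2_eq_square)
    also have "\<dots> = h * (1 - z b0) + h * q\<^sup>2 - h * (b0 / k) * q"
      unfolding k(2) hk ..
    also have "\<dots> = h * RR"
      unfolding RR_def q_def [symmetric] by (simp only: distrib_left right_diff_distrib mult.assoc)
    finally show ?thesis .
  qed
  \<comment> \<open>The two \<open>rho\<close> values have opposite signs or both vanish, so at
    least one is nonnegative. \<open>rho_deriv_pos\<close> applies on that side, and
    \<open>RL_RR\<close> transfers the sign if it is the left one.\<close>
  have "RR > 0"
  proof (cases "rho (z b0) (b0 / k) \<ge> 0")
    case True
    have "z b0 < 1" using r_pos[of b0] h by (simp add: z_def)
    from rho_deriv_pos[OF R this True] show ?thesis by (simp add: RR_def)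
  next
    case False
    then have "rho (x b0) (- b0) \<ge> 0"
      using match[of b0] mult_pos_neg[OF k(1), of "rho (z b0) (b0 / k)"] by linarith
    moreover have "x b0 < 1" using r_pos[of b0] by (simp add: x_def)
    ultimately have "RL > 0" unfolding RL_def by (intro rho_deriv_pos L)
    then show ?thesis using RL_RR h by (simp add: zero_less_mult_iff)
  qed
  have "Q b0 = 0" using match[of b0] by (simp add: Q_def)
  with Q' have "((\<lambda>b. Q b / (b - b0)) \<longlongrightarrow> RR - RL) (at b0)"
    by (simp add: has_field_derivative_iff)
  then have "((\<lambda>b. Q b / (b - b0) / N b) \<longlongrightarrow> (RR - RL) / N b0) (at b0)"
    using N_lim N_pos by (intro tendsto_divide) auto
  \<comment> \<open>Near \<open>b0\<close> the factor \<open>N b\<close> is positive, so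
    \<open>key\<close> can be divided by it to recover the difference quotient of the gap.\<close>
  moreover have "\<forall>\<^sub>F b in at b0. Q b / (b - b0) / N b = (r b - r b0) / (b - b0)"
  proof -
    have "\<forall>\<^sub>F b in at b0. N b > 0" using order_tendstoD(1)[OF N_lim N_pos] .
    with key show ?thesis
    proof eventually_elim
      case (elim b)
      then show ?case by (simp flip: elim(1))
    qed
  qed
  ultimately have "((\<lambda>b. (r b - r b0) / (b - b0)) \<longlongrightarrow> (RR - RL) / N b0) (at b0)"
    by (rule Lim_transform_eventually)
  then have "(r has_real_derivative (1 - h) * (RR / N b0)) (at b0)"
    by (simp add: has_field_derivative_iff RL_RR algebra_simps diff_divide_distrib)
  then show ?thesis
    using \<open>RR > 0\<close> N_pos unfolding r_def [abs_def] by (intro exI[of _ "RR / N b0"]) auto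
qed

theorem proposition15:
  shows "(\<forall>\<beta> \<eta>. \<eta> > 0 \<longrightarrow>
            (\<lambda>b. spectral_gap b \<eta>) differentiable (at \<beta>) \<and>
            sgn (deriv (\<lambda>b. spectral_gap b \<eta>) \<beta>) = - sgn (\<eta> - 1)) \<and>
         (\<forall>\<eta>. 0 < \<eta> \<and> \<eta> < 1 \<longrightarrow> strict_mono (\<lambda>\<beta>. spectral_gap \<beta> \<eta>)) \<and>
         (\<forall>\<eta>. 1 < \<eta> \<longrightarrow> (\<forall>\<beta>1 \<beta>2. \<beta>1 < \<beta>2 \<longrightarrow> spectral_gap \<beta>2 \<eta> < spectral_gap \<beta>1 \<eta>)) \<and>
         (\<forall>\<beta>. spectral_gap \<beta> 1 = 1)"
proof (intro conjI allI impI)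
  fix \<beta> \<eta> :: real assume \<eta>: "\<eta> > 0"
  then obtain D where D: "D > 0" "((\<lambda>b. spectral_gap b \<eta>) has_real_derivative (1 - \<eta>) * D) (at \<beta>)"
    using spectral_gap_deriv by blast
  then show "(\<lambda>b. spectral_gap b \<eta>) differentiable (at \<beta>)"
    by (auto simp: real_differentiable_def)
  show "sgn (deriv (\<lambda>b. spectral_gap b \<eta>) \<beta>) = - sgn (\<eta> - 1)"
  proof -
    have "sgn (1 - \<eta>) = - sgn (\<eta> - 1)" by (simp add: sgn_if)
    then show ?thesis using D(1) by (simp add: DERIV_imp_deriv[OF D(2)] sgn_mult)
  qed
next
  fix \<eta> :: real assume \<eta>: "0 < \<eta> \<and> \<eta> < 1"
  show "strict_mono (\<lambda>\<beta>. spectral_gap \<beta> \<eta>)"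
  proof (rule strict_monoI)
    fix \<beta>1 \<beta>2 :: real assume "\<beta>1 < \<beta>2"
    then show "spectral_gap \<beta>1 \<eta> < spectral_gap \<beta>2 \<eta>"
    proof (rule DERIV_pos_imp_increasing)
      fix x
      from \<eta> obtain D where "D > 0" "((\<lambda>b. spectral_gap b \<eta>) has_real_derivative (1 - \<eta>) * D) (at x)"
        using spectral_gap_deriv by blast
      then show "\<exists>y. ((\<lambda>b. spectral_gap b \<eta>) has_real_derivative y) (at x) \<and> 0 < y"
        using \<eta> by (intro exI[of _ "(1 - \<eta>) * D"]) auto
    qed
  qed
next
  fix \<eta> \<beta>1 \<beta>2 :: real assume \<eta>: "1 < \<eta>" and "\<beta>1 < \<beta>2"
  from this(2) show "spectral_gap \<beta>2 \<eta> < spectral_gap \<beta>1 \<eta>"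
  proof (rule DERIV_neg_imp_decreasing)
    fix x
    from \<eta> obtain D where "D > 0" "((\<lambda>b. spectral_gap b \<eta>) has_real_derivative (1 - \<eta>) * D) (at x)"
      using spectral_gap_deriv[of \<eta> x] by auto
    then show "\<exists>y. ((\<lambda>b. spectral_gap b \<eta>) has_real_derivative y) (at x) \<and> y < 0"
      using \<eta> by (intro exI[of _ "(1 - \<eta>) * D"]) (auto simp: mult_neg_pos)
  qed
next
  \<comment> \<open>For equal slopes the interval [min 1 h, max 1 h] collapses to the single point
    1.\<close>
  show "spectral_gap \<beta> 1 = 1" for \<beta>
    using spectral_gap_ground(2)[of 1 \<beta>] by simp
qed

end
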